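(* Let $\Omega$ be a set, $\mathcal E$ a Hilbert space and $K\colon\Omega\times\Omega\to\mathcal L(\mathcal E)$ a positive kernel. Then there is a uniquely determined Hilbert $C^*$-module $\boldsymbol{\mathcal H}(K)$ over the $C^*$-algebra $\mathcal L(\mathcal E)$ such that: (1) the elements of $\boldsymbol{\mathcal H}(K)$ are $\mathcal L(\mathcal E)$-valued functions on $\Omega$; (2) for each $w\in\Omega$ the function $K(\cdot,w)$ belongs to $\boldsymbol{\mathcal H}(K)$ and the linear span of these functions is dense in $\boldsymbol{\mathcal H}(K)$; (3) for every $F\in\boldsymbol{\mathcal H}(K)$ and $w\in\Omega$, $\langle F,K(\cdot,w)\rangle_{\boldsymbol{\mathcal H}(K)}=F(w)\in\mathcal L(\mathcal E)$.
   Context: A function $K\colon\Omega\times\Omega\to\mathcal L(\mathcal E)$ is a positive kernel if $\sum_{i,j=1}^N\langle K(z_i,z_j)e_j,e_i\rangle_{\mathcal E}\ge 0$ for all $N\ge1$, $z_1,\dots,z_N\in\Omega$, $e_1,\dots,e_N\in\mathcal E$. A Hilbert $C^*$-module over a $C^*$-algebra $\mathfrak B$ is a right $\mathfrak B$-module $E$ with a $\mathfrak B$-valued inner product $\langle\cdot,\cdot\rangle$, linear in the first slot, satisfying $\langle x\cdot b,y\rangle=\langle x,y\rangle b$, $\langle x,y\rangle^*=\langle y,x\rangle$, $\langle x,x\rangle\ge0$ in $\mathfrak B$, $\langle x,x\rangle=0\Rightarrow x=0$, and $E$ complete in the norm $\|x\|=\|\langle x,x\rangle\|^{1/2}$.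
   Formalization: In (2), "linear span" is taken as the right L(E)-module span (finite sums of K(·,w)b with b in L(E)); with the complex linear span the claim fails, e.g. Ω a point, E = ℂ², K = I, where the module is all of L(E) but the span is ℂ·I. *)

theory Defs
  imports "HOL-Analysis.Analysis"
begin

text \<open>A complex Hilbert space is encoded as a real Banach space type 'e together with
  a real-linear operator J (multiplication by the imaginary unit, J o J = -id) and a
  complex-valued inner product ip, linear in the first slot, whose induced norm is the
  norm of the type. Completeness comes from the type class complete_space.\<close>

definition cscale :: "('e::real_vector \<Rightarrow> 'e) \<Rightarrow> complex \<Rightarrow> 'e \<Rightarrow> 'e" where
  "cscale J c x = Re c *\<^sub>R x + Im c *\<^sub>R J x"

definition complex_hilbert ::
  "('e::{real_normed_vector,complete_space} \<Rightarrow> 'e) \<Rightarrow> ('e \<Rightarrow> 'e \<Rightarrow> complex) \<Rightarrow> bool" where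
  "complex_hilbert J ip \<longleftrightarrow>
     linear J \<and> (\<forall>x. J (J x) = - x) \<and>
     (\<forall>x y z. ip (x + y) z = ip x z + ip y z) \<and>
     (\<forall>c x y. ip (cscale J c x) y = c * ip x y) \<and>
     (\<forall>x y. ip x y = cnj (ip y x)) \<and>
     (\<forall>x. ip x x = complex_of_real ((norm x)\<^sup>2))"

definition bop :: "('e::real_normed_vector \<Rightarrow> 'e) \<Rightarrow> ('e \<Rightarrow> 'e) set" where
  "bop J = {T. bounded_linear T \<and> (\<forall>x. T (J x) = J (T x))}"

definition cnonneg :: "complex \<Rightarrow> bool" where
  "cnonneg c \<longleftrightarrow> Im c = 0 \<and> 0 \<le> Re c"

definition positive_kernel ::
  "('e::real_normed_vector \<Rightarrow> 'e) \<Rightarrow> ('e \<Rightarrow> 'e \<Rightarrow> complex) \<Rightarrow> ('w \<Rightarrow> 'w \<Rightarrow> 'e \<Rightarrow> 'e) \<Rightarrow> bool" where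
  "positive_kernel J ip K \<longleftrightarrow>
     (\<forall>z w. K z w \<in> bop J) \<and>
     (\<forall>N (zs::nat \<Rightarrow> 'w) (es::nat \<Rightarrow> 'e).
        cnonneg (\<Sum>i<N. \<Sum>j<N. ip (K (zs i) (zs j) (es j)) (es i)))"

definition hm_norm :: "('h \<Rightarrow> 'h \<Rightarrow> 'e \<Rightarrow> 'e::real_normed_vector) \<Rightarrow> 'h \<Rightarrow> real" where
  "hm_norm ipH F = sqrt (onorm (ipH F F))"

definition hilbert_fun_module ::
  "('e::{real_normed_vector,complete_space} \<Rightarrow> 'e) \<Rightarrow> ('e \<Rightarrow> 'e \<Rightarrow> complex) \<Rightarrow>
   ('w \<Rightarrow> 'e \<Rightarrow> 'e) set \<Rightarrow> (('w \<Rightarrow> 'e \<Rightarrow> 'e) \<Rightarrow> ('w \<Rightarrow> 'e \<Rightarrow> 'e) \<Rightarrow> 'e \<Rightarrow> 'e) \<Rightarrow> bool" where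
  "hilbert_fun_module J ip H ipH \<longleftrightarrow>
     (\<forall>F\<in>H. \<forall>z. F z \<in> bop J) \<and>
     (\<lambda>z x. 0) \<in> H \<and>
     (\<forall>F\<in>H. \<forall>G\<in>H. (\<lambda>z x. F z x + G z x) \<in> H) \<and>
     (\<forall>F\<in>H. \<forall>c. (\<lambda>z x. cscale J c (F z x)) \<in> H) \<and>
     (\<forall>F\<in>H. \<forall>b\<in>bop J. (\<lambda>z. F z \<circ> b) \<in> H) \<and>
     (\<forall>F\<in>H. \<forall>G\<in>H. ipH F G \<in> bop J) \<and>
     (\<forall>F\<in>H. \<forall>G\<in>H. \<forall>L\<in>H. ipH (\<lambda>z x. F z x + G z x) L = (\<lambda>x. ipH F L x + ipH G L x)) \<and>
     (\<forall>F\<in>H. \<forall>G\<in>H. \<forall>c. ipH (\<lambda>z x. cscale J c (F z x)) G = (\<lambda>x. cscale J c (ipH F G x))) \<and>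
     (\<forall>F\<in>H. \<forall>G\<in>H. \<forall>b\<in>bop J. ipH (\<lambda>z. F z \<circ> b) G = ipH F G \<circ> b) \<and>
     (\<forall>F\<in>H. \<forall>G\<in>H. \<forall>x y. ip (ipH F G x) y = ip x (ipH G F y)) \<and>
     (\<forall>F\<in>H. \<forall>x. cnonneg (ip (ipH F F x) x)) \<and>
     (\<forall>F\<in>H. ipH F F = (\<lambda>x. 0) \<longrightarrow> F = (\<lambda>z x. 0)) \<and>
     (\<forall>s::nat \<Rightarrow> ('w \<Rightarrow> 'e \<Rightarrow> 'e). (\<forall>n. s n \<in> H) \<longrightarrow>
        (\<forall>\<epsilon>>0. \<exists>N. \<forall>m\<ge>N. \<forall>n\<ge>N. hm_norm ipH (\<lambda>z x. s m z x - s n z x) < \<epsilon>) \<longrightarrow>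
        (\<exists>F\<in>H. (\<lambda>n. hm_norm ipH (\<lambda>z x. s n z x - F z x)) \<longlonglongrightarrow> 0))"

definition rk_properties ::
  "('e::{real_normed_vector,complete_space} \<Rightarrow> 'e) \<Rightarrow> ('e \<Rightarrow> 'e \<Rightarrow> complex) \<Rightarrow>
   ('w \<Rightarrow> 'w \<Rightarrow> 'e \<Rightarrow> 'e) \<Rightarrow>
   ('w \<Rightarrow> 'e \<Rightarrow> 'e) set \<Rightarrow> (('w \<Rightarrow> 'e \<Rightarrow> 'e) \<Rightarrow> ('w \<Rightarrow> 'e \<Rightarrow> 'e) \<Rightarrow> 'e \<Rightarrow> 'e) \<Rightarrow> bool" where
  "rk_properties J ip K H ipH \<longleftrightarrow>
     (\<forall>w. (\<lambda>z. K z w) \<in> H) \<and>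
     (\<forall>F\<in>H. \<forall>\<epsilon>>0. \<exists>n (ws::nat \<Rightarrow> 'w) (bs::nat \<Rightarrow> 'e \<Rightarrow> 'e).
        (\<forall>i<n. bs i \<in> bop J) \<and>
        hm_norm ipH (\<lambda>z x. F z x - (\<Sum>i<n. K z (ws i) (bs i x))) < \<epsilon>) \<and>
     (\<forall>F\<in>H. \<forall>w. ipH F (\<lambda>z. K z w) = F w)"

end

theory Submission
  imports Defs
begin

text \<open>Let \<open>\<H>\<close> be the reproducing kernel Hilbert space of \<open>K\<close>, consisting of vector-valued functions. A
  member \<open>F\<close> of the module is a bounded operator \<open>x \<mapsto> F(\<cdot>)x\<close> into \<open>\<H>\<close>, approximable in operator norm by
  finite sums of \<open>K(\<cdot>, w) b\<close>, and \<open>\<langle>F, G\<rangle>\<close> is the operator representing the sesquilinear form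
  \<open>(x, y) \<mapsto> \<langle>F(\<cdot>)x, G(\<cdot>)y\<rangle>\<close> by Riesz. For uniqueness, the reproducing property fixes the inner
  product with every finite sum \<open>\<Sum> K(\<cdot>, w\<^sub>i) b\<^sub>i\<close>, so two such modules induce the same norm on these sums;
  by density, completeness and continuity of point evaluations they coincide.\<close>

text \<open>Approximability in operator norm is what density of the finite sums demands; the bounded
  operators into \<H> can form a strictly larger space. If \<open>K z w\<close> is the identity for
  \<open>z = w\<close> and 0 otherwise, over an infinite set and an infinite-dimensional Hilbert
  space, put at the points of a sequence the projections onto the members of an orthonormal
  sequence, and 0 elsewhere: this operator is bounded and has distance at least 1 from every finite
  sum. \<H> is never built as a space. All that is used of a function \<open>f\<close> is its
  pairing with finite sums of kernel functions; the reproducing property prescribes this value,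
  which makes sense for every \<open>f\<close>. The price is an asymmetry: the inner product is a
  limit of such pairings, so one of its arguments must come with approximating sums, and hermitian
  symmetry needs its own argument. The norm of a module is read off from the operator norm of
  \<open>\<langle>F, F\<rangle>\<close>. For an arbitrary competitor in the uniqueness part,
  Cauchy-Schwarz and the triangle inequality must therefore be derived from the module
  axioms.\<close>

text \<open>Choosing \<open>t = - r * cnj b\<close> removes the phase of \<open>b\<close> and leaves
  a real quadratic in \<open>r\<close>. This is the core of Cauchy-Schwarz, isolated because it
  serves three positive forms: \<open>ip\<close>, the form on formal kernel sums, and the diagonal
  values of a module inner product.\<close>

lemma norm_le_sqrt_mult_if_quadratic_nonneg:
  fixes b :: complex and a c :: real
  assumes nn: "\<And>t. 0 \<le> a + 2 * Re (t * b) + (cmod t)\<^sup>2 * c" and c: "0 \<le> c"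
  shows "cmod b \<le> sqrt a * sqrt c"
proof -
  have a: "0 \<le> a"
    using nn[of 0] by simp
  have r: "0 \<le> a - 2 * r * (cmod b)\<^sup>2 + r\<^sup>2 * (cmod b)\<^sup>2 * c" for r :: real
  proof -
    have "Re (complex_of_real (- r) * cnj b * b) = - r * (cmod b)\<^sup>2"
      by (simp add: cmod_power2) (simp add: power2_eq_square algebra_simps)
    with nn[of "complex_of_real (- r) * cnj b"] show ?thesis
      by (simp add: norm_mult power_mult_distrib)
  qed
  have "(cmod b)\<^sup>2 \<le> a * c"
  proof (cases "c = 0")
    case True
    show ?thesis
    proof (rule ccontr)
      assume "\<not> ?thesis"
      then have b: "(cmod b)\<^sup>2 > 0" using True by simp
      \<comment> \<open>With \<open>c = 0\<close> the quadratic is affine in \<open>r\<close>; at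
        this \<open>r\<close> its value is \<open>a - 2 * (a + 1)\<close>, which is
        negative.\<close>
      show False
        using r[of "(a + 1) / (cmod b)\<^sup>2"] True b a by simp
    qed
  next
    case False
    then have "0 < c" using c by simp
    \<comment> \<open>The quadratic in \<open>r\<close> is minimal at
      \<open>r = 1 / c\<close>.\<close>
    have "0 \<le> c * (a - 2 * (1 / c) * (cmod b)\<^sup>2 + (1 / c)\<^sup>2 * (cmod b)\<^sup>2 * c)"
      using r[of "1 / c"] c by simp
    also have "\<dots> = a * c - (cmod b)\<^sup>2"
      using \<open>0 < c\<close> by (simp add: field_simps power2_eq_square)
    finally show ?thesis by simp
  qed
  then have "sqrt ((cmod b)\<^sup>2) \<le> sqrt (a * c)"
    by (rule real_sqrt_le_mono)
  then show ?thesis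
    by (simp add: real_sqrt_mult)
qed

section \<open>Complex Hilbert spaces\<close>

locale chilbert =
  fixes J :: "'e::{real_normed_vector,complete_space} \<Rightarrow> 'e"
    and ip :: "'e \<Rightarrow> 'e \<Rightarrow> complex"
  assumes complex_hilbert: "complex_hilbert J ip"
begin

lemma linear_J: "linear J"
  using complex_hilbert unfolding complex_hilbert_def by blast

lemma J_J: "J (J x) = - x"
  using complex_hilbert unfolding complex_hilbert_def by blast

lemma ip_add_left: "ip (x + y) z = ip x z + ip y z"
  using complex_hilbert unfolding complex_hilbert_def by blast

lemma ip_cscale_left: "ip (cscale J c x) y = c * ip x y"
  using complex_hilbert unfolding complex_hilbert_def by blast

lemma ip_hermitian: "ip x y = cnj (ip y x)"
  using complex_hilbert unfolding complex_hilbert_def by blast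

lemma ip_self: "ip x x = complex_of_real ((norm x)\<^sup>2)"
  using complex_hilbert unfolding complex_hilbert_def by blast

lemma ip_add_right: "ip x (y + z) = ip x y + ip x z"
  by (metis ip_hermitian ip_add_left complex_cnj_add)

lemma ip_cscale_right: "ip x (cscale J c y) = cnj c * ip x y"
  by (metis ip_hermitian ip_cscale_left complex_cnj_mult)

lemma cscale_of_real: "cscale J (complex_of_real r) x = r *\<^sub>R x"
  by (simp add: cscale_def)

lemma cscale_ii: "cscale J \<i> x = J x"
  by (simp add: cscale_def)

lemma cscale_minus_one: "cscale J (- 1) x = - x"
  using cscale_of_real[of "- 1" x] by simp

lemma cscale_add: "cscale J c (x + y) = cscale J c x + cscale J c y"
  by (simp add: cscale_def linear_add[OF linear_J] algebra_simps)

lemma cscale_scaleR: "cscale J c (r *\<^sub>R x) = r *\<^sub>R cscale J c x"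
  by (simp add: cscale_def linear_cmul[OF linear_J] algebra_simps)

lemma cscale_zero: "cscale J c 0 = 0"
  by (simp add: cscale_def linear_0[OF linear_J])

lemma ip_J_left: "ip (J x) y = \<i> * ip x y"
  using ip_cscale_left[of \<i>] by (simp add: cscale_ii)

lemma ip_J_right: "ip x (J y) = - \<i> * ip x y"
  using ip_cscale_right[of _ \<i>] by (simp add: cscale_ii)

lemma ip_scaleR_left: "ip (r *\<^sub>R x) y = r *\<^sub>R ip x y"
  using ip_cscale_left[of "complex_of_real r"] by (simp add: cscale_of_real scaleR_conv_of_real)

lemma ip_scaleR_right: "ip x (r *\<^sub>R y) = r *\<^sub>R ip x y"
  using ip_cscale_right[of _ "complex_of_real r"] by (simp add: cscale_of_real scaleR_conv_of_real)

lemma ip_zero_left [simp]: "ip 0 y = 0"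
  using ip_scaleR_left[of 0 0 y] by simp

lemma ip_zero_right [simp]: "ip x 0 = 0"
  using ip_scaleR_right[of x 0 0] by simp

lemma ip_minus_left: "ip (- x) y = - ip x y"
  using ip_scaleR_left[of "- 1" x y] by simp

lemma ip_minus_right: "ip x (- y) = - ip x y"
  using ip_scaleR_right[of x "- 1" y] by simp

lemma ip_diff_left: "ip (x - y) z = ip x z - ip y z"
  using ip_add_left[of x "- y" z] by (simp add: ip_minus_left)

lemma ip_diff_right: "ip x (y - z) = ip x y - ip x z"
  using ip_add_right[of x y "- z"] by (simp add: ip_minus_right)

lemma ip_sum_left: "ip (sum f A) y = (\<Sum>i\<in>A. ip (f i) y)"
  by (induction A rule: infinite_finite_induct) (simp_all add: ip_add_left)

lemma norm_add_cscale:
  "(norm (x + cscale J t y))\<^sup>2 = (norm x)\<^sup>2 + 2 * Re (t * ip y x) + (cmod t)\<^sup>2 * (norm y)\<^sup>2"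
proof -
  have *: "ip x (cscale J t y) = cnj (t * ip y x)"
    using ip_hermitian[of x "cscale J t y"] by (simp add: ip_cscale_left)
  have "complex_of_real ((norm (x + cscale J t y))\<^sup>2)
      = ip x x + (t * ip y x + cnj (t * ip y x)) + t * cnj t * ip y y"
    by (simp only: ip_self[symmetric] ip_add_left ip_add_right * ) (simp add: ip_cscale_left ip_cscale_right)
  also have "\<dots> = complex_of_real ((norm x)\<^sup>2 + 2 * Re (t * ip y x) + (cmod t)\<^sup>2 * (norm y)\<^sup>2)"
    by (simp only: ip_self complex_add_cnj complex_norm_square[symmetric]) simp
  finally show ?thesis
    by (simp only: of_real_eq_iff)
qed

lemma cmod_ip_le: "cmod (ip x y) \<le> norm x * norm y"
proof -
  have "0 \<le> (norm y)\<^sup>2 + 2 * Re (t * ip x y) + (cmod t)\<^sup>2 * (norm x)\<^sup>2" for t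
    by (metis norm_add_cscale zero_le_power2)
  then have "cmod (ip x y) \<le> sqrt ((norm y)\<^sup>2) * sqrt ((norm x)\<^sup>2)"
    by (rule norm_le_sqrt_mult_if_quadratic_nonneg) simp
  then show ?thesis
    by (simp add: mult.commute)
qed

lemma bounded_linear_ip_left: "bounded_linear (\<lambda>x. ip x y)"
  by (rule bounded_linear_intro[of _ "norm y"])
    (simp_all add: ip_add_left ip_scaleR_left cmod_ip_le)

lemma ip_eqI:
  assumes "\<And>y. ip u y = ip v y"
  shows "u = v"
proof -
  have "ip (u - v) (u - v) = 0"
    by (simp add: ip_diff_left assms)
  then show ?thesis
    by (simp add: ip_self)
qed

text \<open>Testing with \<open>y = u\<close> is enough. Bounds on sesquilinear forms become
  operator bounds this way.\<close>

lemma norm_le_if_ip_le: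
  assumes "0 \<le> C" and "\<And>y. cmod (ip u y) \<le> C * norm y"
  shows "norm u \<le> C"
proof (cases "u = 0")
  case False
  have "norm u * norm u \<le> C * norm u"
    using assms(2)[of u] by (simp add: ip_self norm_mult power2_eq_square)
  then show ?thesis
    using False by simp
qed (simp add: assms)

lemma bounded_linear_cscale: "bounded_linear (cscale J c)"
proof (rule bounded_linear_intro[of _ "cmod c"])
  fix x
  have "(norm (cscale J c x))\<^sup>2 = (cmod c * norm x)\<^sup>2"
    using norm_add_cscale[of 0 c x] by (simp add: power_mult_distrib)
  then have "norm (cscale J c x) = cmod c * norm x"
    by (simp add: power2_eq_iff_nonneg)
  then show "norm (cscale J c x) \<le> norm x * cmod c"
    by simp
qed (simp_all add: cscale_add cscale_scaleR)

lemma cscale_J: "cscale J c (J x) = J (cscale J c x)"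
  by (simp add: cscale_def linear_add[OF linear_J] linear_cmul[OF linear_J])

section \<open>Bounded complex-linear operators\<close>

lemma bop_bounded_linear: "b \<in> bop J \<Longrightarrow> bounded_linear b"
  by (simp add: bop_def)

lemma bop_linear: "b \<in> bop J \<Longrightarrow> linear b"
  by (simp add: bop_def bounded_linear.linear)

lemma bop_J: "b \<in> bop J \<Longrightarrow> b (J x) = J (b x)"
  by (simp add: bop_def)

lemma bop_add: "b \<in> bop J \<Longrightarrow> b (x + y) = b x + b y"
  by (rule linear_add[OF bop_linear])

lemma bop_scaleR: "b \<in> bop J \<Longrightarrow> b (r *\<^sub>R x) = r *\<^sub>R b x"
  by (rule linear_cmul[OF bop_linear])

lemma bop_cscale_apply: "b \<in> bop J \<Longrightarrow> b (cscale J c x) = cscale J c (b x)"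
  by (simp add: cscale_def bop_add bop_scaleR bop_J)

lemma id_in_bop: "(\<lambda>x. x) \<in> bop J"
  by (simp add: bop_def bounded_linear_ident)

lemma comp_in_bop: "a \<in> bop J \<Longrightarrow> b \<in> bop J \<Longrightarrow> (\<lambda>x. a (b x)) \<in> bop J"
  by (simp add: bop_def bounded_linear_compose)

lemma cscale_in_bop: "cscale J c \<in> bop J"
  by (simp add: bop_def bounded_linear_cscale cscale_J)

lemma add_in_bop: "a \<in> bop J \<Longrightarrow> b \<in> bop J \<Longrightarrow> (\<lambda>x. a x + b x) \<in> bop J"
  by (simp add: bop_def bounded_linear_add linear_add[OF linear_J])

lemma zero_in_bop: "(\<lambda>x. 0) \<in> bop J"
  by (simp add: bop_def bounded_linear_zero linear_0[OF linear_J])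

lemma rank_one_in_bop: "(\<lambda>x. cscale J (ip x u) v) \<in> bop J"
proof -
  have "bounded_linear (\<lambda>x. Re (ip x u) *\<^sub>R v + Im (ip x u) *\<^sub>R J v)"
    by (intro bounded_linear_add bounded_linear_scaleR_const
        bounded_linear_compose[OF bounded_linear_Re] bounded_linear_compose[OF bounded_linear_Im]
        bounded_linear_ip_left)
  moreover have "cscale J (ip (J x) u) v = J (cscale J (ip x u) v)" for x
    by (simp add: ip_J_left cscale_def linear_add[OF linear_J] linear_cmul[OF linear_J] J_J)
  ultimately show ?thesis
    by (simp add: bop_def cscale_def)
qed

text \<open>A rank-one operator does it. The point is that the right action of \<open>bop J\<close>
  can move any nonzero vector to any other, which later reduces off-diagonal estimates to the
  diagonal ones governed by positivity.\<close>

lemma ex_bop_map: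
  assumes "x \<noteq> 0"
  shows "\<exists>b\<in>bop J. b x = y"
proof
  \<comment> \<open>Scaled so that \<open>ip x ?u = 1\<close>.\<close>
  let ?u = "(1 / (norm x)\<^sup>2) *\<^sub>R x"
  show "(\<lambda>t. cscale J (ip t ?u) y) \<in> bop J"
    by (rule rank_one_in_bop)
  show "cscale J (ip x ?u) y = y"
    using assms by (simp add: ip_scaleR_right ip_self cscale_of_real scaleR_conv_of_real)
      (simp add: cscale_def)
qed

text \<open>The vector \<open>u\<close> minimises \<open>\<lambda>y. (norm y)\<^sup>2 - 2 * \<rho> y\<close>; minimising sequences are Cauchy by the
  parallelogram law.\<close>

lemma riesz_real:
  assumes \<rho>: "bounded_linear \<rho>"
  shows "\<exists>u. \<forall>y. Re (ip u y) = \<rho> y"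
proof -
  interpret \<rho>: bounded_linear \<rho> by (rule \<rho>)
  obtain C where C: "\<And>y. norm (\<rho> y) \<le> norm y * C"
    using \<rho>.bounded by blast
  define q where "q y = (norm y)\<^sup>2 - 2 * \<rho> y" for y
  define m where "m = (INF y. q y)"
  \<comment> \<open>Completing the square: \<open>q y\<close> is at least
    \<open>(norm y - C)\<^sup>2 - C\<^sup>2\<close>.\<close>
  have lower: "- C\<^sup>2 \<le> q y" for y
  proof -
    have "\<rho> y \<le> norm y * C" using C[of y] by simp
    moreover have "0 \<le> (norm y - C)\<^sup>2" by simp
    ultimately show ?thesis
      by (simp add: q_def power2_eq_square algebra_simps)
  qed
  then have bdd: "bdd_below (range q)"
    by (auto simp: bdd_below_def)
  have m_le: "m \<le> q y" for y
    unfolding m_def by (rule cINF_lower[OF bdd]) simp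
  have "\<exists>y. q y < m + 1 / real (Suc n)" for n
    using cINF_less_iff[OF _ bdd, of "m + 1 / real (Suc n)"] by (auto simp: m_def)
  then obtain y where y: "\<And>n. q (y n) < m + 1 / real (Suc n)"
    by metis
  have norm_add: "(norm (a + r *\<^sub>R b))\<^sup>2 = (norm a)\<^sup>2 + 2 * r * Re (ip a b) + r\<^sup>2 * (norm b)\<^sup>2" for a b r
    using norm_add_cscale[of a "complex_of_real r" b] ip_hermitian[of b a]
    by (simp add: cscale_of_real)
  have par: "(norm (a - b))\<^sup>2 = 2 * q a + 2 * q b - 4 * q ((1 / 2) *\<^sub>R (a + b))" for a b
  proof -
    have "(norm ((1 / 2) *\<^sub>R (a + b)))\<^sup>2 = (norm (a + b))\<^sup>2 / 4"
      by (simp add: power_divide)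
    then show ?thesis
      using norm_add[of a 1 b] norm_add[of a "- 1" b]
      by (simp only: q_def \<rho>.add \<rho>.scaleR) (simp add: field_simps)
  qed
  have dist_y: "(norm (y n - y k))\<^sup>2 < 2 / real (Suc n) + 2 / real (Suc k)" for n k
    using par[of "y n" "y k"] y[of n] y[of k] m_le[of "(1 / 2) *\<^sub>R (y n + y k)"] by simp
  have "Cauchy y"
  proof (rule metric_CauchyI)
    fix e :: real assume e: "0 < e"
    \<comment> \<open>Each of the two terms bounding the squared distance is then below half of
      \<open>e\<^sup>2\<close>.\<close>
    obtain M where M: "4 / e\<^sup>2 < real M"
      using reals_Archimedean2 by blast
    have "dist (y n) (y k) < e" if "M \<le> n" "M \<le> k" for n k
    proof -
      have *: "2 / real (Suc j) < e\<^sup>2 / 2" if "M \<le> j" for j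
      proof -
        have "4 / e\<^sup>2 < real (Suc j)" using M that by simp
        then show ?thesis using e by (simp add: field_simps)
      qed
      have "(norm (y n - y k))\<^sup>2 < e\<^sup>2"
        using dist_y[of n k] *[of n] *[of k] that by simp
      then show ?thesis
        using e by (simp add: dist_norm power2_less_imp_less)
    qed
    then show "\<exists>M. \<forall>n\<ge>M. \<forall>k\<ge>M. dist (y n) (y k) < e" by blast
  qed
  then obtain u where u: "y \<longlonglongrightarrow> u"
    using Cauchy_convergent convergent_def by blast
  have "(\<lambda>n. q (y n)) \<longlonglongrightarrow> q u"
    unfolding q_def by (intro tendsto_intros \<rho>.tendsto u)
  moreover have "(\<lambda>n. m + 1 / real (Suc n)) \<longlonglongrightarrow> m + 0"
    by (intro tendsto_intros LIMSEQ_Suc[OF lim_1_over_n])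
  ultimately have "q u \<le> m + 0"
    by (rule LIMSEQ_le) (use y less_imp_le in blast)
  then have min: "q u \<le> q v" for v
    using m_le[of v] by simp
  have "Re (ip u v) = \<rho> v" for v
  proof -
    define d where "d = Re (ip u v) - \<rho> v"
    have quad: "0 \<le> 2 * r * d + r\<^sup>2 * (norm v)\<^sup>2" for r
      using min[of "u + r *\<^sub>R v"] norm_add[of u r v]
      by (simp add: q_def d_def \<rho>.add \<rho>.scaleR algebra_simps)
    \<comment> \<open>The step \<open>r = - d / s\<close> makes the first variation negative unless
      \<open>d = 0\<close>; the summand 1 keeps \<open>s\<close> positive even for
      \<open>v = 0\<close>.\<close>
    define s where "s = 1 + (norm v)\<^sup>2"
    have "0 < s" by (simp add: s_def add_pos_nonneg)
    have v: "(norm v)\<^sup>2 = s - 1" by (simp add: s_def)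
    have "0 \<le> (2 * (- d / s) * d + (- d / s)\<^sup>2 * (s - 1)) * s\<^sup>2"
      by (rule mult_nonneg_nonneg[OF quad[unfolded v]]) simp
    also have "\<dots> = - d\<^sup>2 * (s + 1)"
      using \<open>0 < s\<close> by (simp add: field_simps power2_eq_square)
    finally have "d\<^sup>2 * (s + 1) \<le> 0" by simp
    then have "d\<^sup>2 \<le> 0"
      using \<open>0 < s\<close> by (simp add: mult_le_0_iff)
    then show ?thesis by (simp add: d_def)
  qed
  then show ?thesis by blast
qed

text \<open>The real part alone determines a conjugate-linear functional: \<phi>
  (\<open>J y\<close>) is -\<i> times \<phi> \<open>y\<close>, so its real part is the imaginary
  part of \<phi> \<open>y\<close>. Conjugate-linearity is the right hypothesis because
  \<open>ip\<close> is conjugate-linear in its second slot.\<close>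

lemma riesz:
  assumes add: "\<And>y z. \<phi> (y + z) = \<phi> y + \<phi> z"
    and cscale: "\<And>c y. \<phi> (cscale J c y) = cnj c * \<phi> y"
    and bound: "\<And>y. cmod (\<phi> y) \<le> C * norm y"
  shows "\<exists>u. \<forall>y. ip u y = \<phi> y"
proof -
  have "bounded_linear (\<lambda>y. Re (\<phi> y))"
  proof (rule bounded_linear_intro[of _ C])
    fix r y
    show "Re (\<phi> (r *\<^sub>R y)) = r *\<^sub>R Re (\<phi> y)"
      using cscale[of "complex_of_real r" y] by (simp add: cscale_of_real)
    show "norm (Re (\<phi> y)) \<le> norm y * C"
      using bound[of y] abs_Re_le_cmod[of "\<phi> y"] by (simp add: mult.commute)
  qed (simp add: add)
  then obtain u where u: "\<And>y. Re (ip u y) = Re (\<phi> y)"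
    using riesz_real by blast
  have "ip u y = \<phi> y" for y
    using u[of y] u[of "J y"] cscale[of \<i> y] by (simp add: complex_eq_iff ip_J_right cscale_ii)
  then show ?thesis by blast
qed

end


section \<open>The scalar reproducing kernel space\<close>

locale kernel = chilbert J ip
  for J :: "'e::{real_normed_vector,complete_space} \<Rightarrow> 'e" and ip +
  fixes K :: "'w \<Rightarrow> 'w \<Rightarrow> 'e \<Rightarrow> 'e"
  assumes positive_kernel: "positive_kernel J ip K"
begin

lemma K_in_bop: "K z w \<in> bop J"
  using positive_kernel by (simp add: positive_kernel_def)

lemma K_positive: "cnonneg (\<Sum>i<N. \<Sum>j<N. ip (K (zs i) (zs j) (es j)) (es i))"
  for zs :: "nat \<Rightarrow> 'w"
  using positive_kernel by (simp add: positive_kernel_def)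

text \<open>The imaginary part of the two-point positivity condition, tested on \<open>(e, f)\<close> and \<open>(J e, f)\<close>.\<close>

lemma K_adjoint: "ip (K z w e) f = ip e (K w z f)"
proof -
  have diag: "Im (ip (K v v a) a) = 0" for v a
    using K_positive[of "\<lambda>_. v" "\<lambda>_. a" 1] by (simp add: cnonneg_def)
  have *: "Im (ip (K z w a) f + ip (K w z f) a) = 0" for a
    using K_positive[of "\<lambda>i. if i = 0 then z else w" "\<lambda>i. if i = 0 then f else a" 2]
      diag[of z f] diag[of w a]
    by (simp add: cnonneg_def numeral_2_eq_2)
  have "ip (K z w e) f = cnj (ip (K w z f) e)"
    using *[of e] *[of "J e"]
    by (simp add: complex_eq_iff bop_J[OF K_in_bop] ip_J_left ip_J_right)
  then show ?thesis
    by (metis ip_hermitian)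
qed

text \<open>A list of pairs \<open>(w, e)\<close> stands for the formal sum of the functions \<open>K(\<cdot>, w) e\<close>, so that no
  independence of the representation has to be checked.\<close>

definition kfun :: "('w \<times> 'e) list \<Rightarrow> 'w \<Rightarrow> 'e" where
  "kfun l z = (\<Sum>(w, e)\<leftarrow>l. K z w e)"

text \<open>By the reproducing property this is the inner product of \<open>f\<close> with
  \<open>kfun l\<close> in the reproducing kernel Hilbert space; the formula itself asks nothing of
  \<open>f\<close>.\<close>

definition pairing :: "('w \<Rightarrow> 'e) \<Rightarrow> ('w \<times> 'e) list \<Rightarrow> complex" where
  "pairing f l = (\<Sum>(w, e)\<leftarrow>l. ip (f w) e)"

text \<open>The squared Hilbert space norm of \<open>kfun l\<close>. Nothing is lost in the real
  part, since positivity of the kernel makes the pairing real.\<close>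

definition energy :: "('w \<times> 'e) list \<Rightarrow> real" where
  "energy l = Re (pairing (kfun l) l)"

definition cscale_list :: "complex \<Rightarrow> ('w \<times> 'e) list \<Rightarrow> ('w \<times> 'e) list" where
  "cscale_list c l = map (\<lambda>(w, e). (w, cscale J c e)) l"

lemma kfun_Nil [simp]: "kfun [] z = 0"
  by (simp add: kfun_def)

lemma kfun_Cons [simp]: "kfun ((w, e) # l) z = K z w e + kfun l z"
  by (simp add: kfun_def)

lemma kfun_append: "kfun (l @ m) z = kfun l z + kfun m z"
  by (simp add: kfun_def)

lemma kfun_cscale_list: "kfun (cscale_list c l) z = cscale J c (kfun l z)"
  unfolding cscale_list_def
  by (induction l) (auto simp: cscale_zero cscale_add bop_cscale_apply[OF K_in_bop])

lemma pairing_Nil [simp]: "pairing f [] = 0"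
  by (simp add: pairing_def)

lemma pairing_Cons [simp]: "pairing f ((w, e) # l) = ip (f w) e + pairing f l"
  by (simp add: pairing_def)

lemma pairing_append: "pairing f (l @ m) = pairing f l + pairing f m"
  by (simp add: pairing_def)

lemma pairing_cscale_list: "pairing f (cscale_list c l) = cnj c * pairing f l"
  unfolding cscale_list_def
  by (induction l) (auto simp: ip_cscale_right algebra_simps)

lemma pairing_add: "pairing (\<lambda>z. f z + g z) l = pairing f l + pairing g l"
  by (induction l) (auto simp: ip_add_left)

lemma pairing_diff: "pairing (\<lambda>z. f z - g z) l = pairing f l - pairing g l"
  by (induction l) (auto simp: ip_diff_left)

lemma pairing_cscale: "pairing (\<lambda>z. cscale J c (f z)) l = c * pairing f l"
  by (induction l) (auto simp: ip_cscale_left algebra_simps)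

lemma pairing_zero: "pairing (\<lambda>z. 0) l = 0"
  by (induction l) auto

lemma pairing_K: "pairing (\<lambda>z. K z w e) l = ip e (kfun l w)"
  by (induction l) (auto simp: K_adjoint ip_add_right)

text \<open>Peeling pairs off \<open>l\<close> reduces the claim to the symmetry of
  \<open>K\<close>. It also shows that \<open>pairing (kfun l) m\<close> depends on the list
  \<open>m\<close> only through the function \<open>kfun m\<close>.\<close>

lemma pairing_kfun_hermitian: "pairing (kfun l) m = cnj (pairing (kfun m) l)"
proof (induction l)
  case Nil
  have "kfun [] = (\<lambda>z. 0)" by (rule ext) simp
  then show ?case by (simp add: pairing_zero)
next
  case (Cons p l)
  obtain w e where p: "p = (w, e)" by fastforce
  have "kfun (p # l) = (\<lambda>z. K z w e + kfun l z)"
    by (rule ext) (simp add: p)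
  then have "pairing (kfun (p # l)) m = ip e (kfun m w) + cnj (pairing (kfun m) l)"
    by (simp add: pairing_add pairing_K Cons.IH)
  also have "\<dots> = cnj (pairing (kfun m) (p # l))"
    using ip_hermitian[of e "kfun m w"] by (simp add: p)
  finally show ?case .
qed

lemma cnonneg_pairing_kfun: "cnonneg (pairing (kfun l) l)"
proof -
  let ?zs = "\<lambda>i. fst (l ! i)" and ?es = "\<lambda>i. snd (l ! i)"
  have "kfun l z = (\<Sum>j<length l. K z (?zs j) (?es j))" for z
    by (simp add: kfun_def sum_list_sum_nth atLeast0LessThan case_prod_beta)
  then have "pairing (kfun l) l = (\<Sum>i<length l. \<Sum>j<length l. ip (K (?zs i) (?zs j) (?es j)) (?es i))"
    by (simp add: pairing_def sum_list_sum_nth atLeast0LessThan case_prod_beta ip_sum_left)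
  then show ?thesis
    using K_positive[of ?zs ?es "length l"] by simp
qed

lemma energy_nonneg [simp]: "0 \<le> energy l"
  using cnonneg_pairing_kfun by (simp add: energy_def cnonneg_def)

lemma pairing_kfun_self: "pairing (kfun l) l = complex_of_real (energy l)"
  using cnonneg_pairing_kfun[of l] by (simp add: energy_def cnonneg_def complex_eq_iff)

text \<open>Appending and scaling lists are addition and scaling of formal sums, so this is the
  expansion of the squared norm of \<open>kfun l\<close> plus \<open>t\<close> times
  \<open>kfun m\<close>, in the shape that the quadratic criterion for Cauchy-Schwarz
  expects.\<close>

lemma energy_append_cscale_list:
  "energy (l @ cscale_list t m) = energy l + 2 * Re (t * pairing (kfun m) l) + (cmod t)\<^sup>2 * energy m"
proof -
  have *: "kfun (l @ cscale_list t m) = (\<lambda>z. kfun l z + cscale J t (kfun m z))"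
    by (rule ext) (simp add: kfun_append kfun_cscale_list)
  have "cnj t * pairing (kfun l) m = cnj (t * pairing (kfun m) l)"
    using pairing_kfun_hermitian[of l m] by simp
  then have "pairing (kfun (l @ cscale_list t m)) (l @ cscale_list t m)
      = complex_of_real (energy l) + (t * pairing (kfun m) l + cnj (t * pairing (kfun m) l))
        + (t * cnj t) * complex_of_real (energy m)"
    by (simp only: * pairing_add pairing_append pairing_cscale_list pairing_cscale
        pairing_kfun_self[symmetric]) (simp add: algebra_simps)
  also have "\<dots> = complex_of_real (energy l + 2 * Re (t * pairing (kfun m) l) + (cmod t)\<^sup>2 * energy m)"
    by (simp only: complex_add_cnj complex_norm_square[symmetric]) simp
  finally show ?thesis
    by (simp only: pairing_kfun_self of_real_eq_iff)
qed

lemma cmod_pairing_kfun_le: "cmod (pairing (kfun l) m) \<le> sqrt (energy l) * sqrt (energy m)"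
proof -
  have "0 \<le> energy m + 2 * Re (t * pairing (kfun l) m) + (cmod t)\<^sup>2 * energy l" for t
    by (metis energy_append_cscale_list energy_nonneg)
  then have "cmod (pairing (kfun l) m) \<le> sqrt (energy m) * sqrt (energy l)"
    by (rule norm_le_sqrt_mult_if_quadratic_nonneg) simp
  then show ?thesis
    by (simp add: mult.commute)
qed

text \<open>\<open>norm_bound f C\<close> says that \<open>f\<close> lies in the reproducing kernel Hilbert space of \<open>K\<close>
  with norm at most \<open>C\<close>; this dual description makes closed balls pointwise closed, which gives
  completeness without a completion.\<close>

definition norm_bound :: "('w \<Rightarrow> 'e) \<Rightarrow> real \<Rightarrow> bool" where
  "norm_bound f C \<longleftrightarrow> 0 \<le> C \<and> (\<forall>l. cmod (pairing f l) \<le> C * sqrt (energy l))"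

lemma norm_boundD: "norm_bound f C \<Longrightarrow> cmod (pairing f l) \<le> C * sqrt (energy l)"
  by (simp add: norm_bound_def)

lemma norm_bound_nonneg: "norm_bound f C \<Longrightarrow> 0 \<le> C"
  by (simp add: norm_bound_def)

lemma norm_bound_mono: "norm_bound f C \<Longrightarrow> C \<le> D \<Longrightarrow> norm_bound f D"
  unfolding norm_bound_def by (meson energy_nonneg mult_right_mono order_trans real_sqrt_ge_zero)

lemma norm_bound_add:
  assumes "norm_bound f C" "norm_bound g D"
  shows "norm_bound (\<lambda>z. f z + g z) (C + D)"
  unfolding norm_bound_def
proof (intro conjI allI)
  show "0 \<le> C + D" using assms by (simp add: norm_bound_def)
  fix l
  have "cmod (pairing f l + pairing g l) \<le> C * sqrt (energy l) + D * sqrt (energy l)"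
    using assms by (meson add_mono norm_boundD norm_triangle_le)
  then show "cmod (pairing (\<lambda>z. f z + g z) l) \<le> (C + D) * sqrt (energy l)"
    by (simp add: pairing_add algebra_simps)
qed

lemma norm_bound_cscale:
  assumes "norm_bound f C"
  shows "norm_bound (\<lambda>z. cscale J c (f z)) (cmod c * C)"
  using assms unfolding norm_bound_def
  by (simp add: pairing_cscale norm_mult mult.assoc mult_left_mono)

lemma norm_bound_diff:
  assumes "norm_bound f C" "norm_bound g D"
  shows "norm_bound (\<lambda>z. f z - g z) (C + D)"
  using norm_bound_add[OF assms(1) norm_bound_cscale[OF assms(2), of "- 1"]]
  by (simp add: cscale_minus_one)

lemma norm_bound_zero: "0 \<le> C \<Longrightarrow> norm_bound (\<lambda>z. 0) C"
  by (simp add: norm_bound_def pairing_zero)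

lemma norm_bound_kfun: "norm_bound (kfun l) (sqrt (energy l))"
  by (simp add: norm_bound_def cmod_pairing_kfun_le)

text \<open>The dual norm of a kernel sum is attained by pairing it with itself. Hence
  \<open>sqrt (energy l)\<close> is the least bound of \<open>kfun l\<close>.\<close>

lemma sqrt_energy_le:
  assumes "norm_bound (kfun l) C"
  shows "sqrt (energy l) \<le> C"
proof (cases "energy l = 0")
  case True
  then show ?thesis using assms by (simp add: norm_bound_def)
next
  case False
  then have pos: "0 < sqrt (energy l)" by (simp add: less_le)
  have "energy l \<le> C * sqrt (energy l)"
    using norm_boundD[OF assms, of l] by (simp add: pairing_kfun_self)
  then have "sqrt (energy l) * sqrt (energy l) \<le> C * sqrt (energy l)"
    by simp
  then show ?thesis
    using pos by (simp only: mult_le_cancel_right_pos)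
qed

lemma energy_single: "energy [(w, e)] \<le> onorm (K w w) * (norm e)\<^sup>2"
proof -
  have "energy [(w, e)] = Re (ip (K w w e) e)"
    by (simp add: energy_def)
  also have "\<dots> \<le> norm (K w w e) * norm e"
    using cmod_ip_le[of "K w w e" e] complex_Re_le_cmod order_trans by blast
  also have "\<dots> \<le> (onorm (K w w) * norm e) * norm e"
    by (intro mult_right_mono onorm bop_bounded_linear K_in_bop) simp
  finally show ?thesis
    by (simp add: power2_eq_square mult.assoc)
qed

lemma sqrt_energy_single: "sqrt (energy [(w, e)]) \<le> sqrt (onorm (K w w)) * norm e"
  using real_sqrt_le_mono[OF energy_single[of w e]] by (simp add: real_sqrt_mult)

lemma norm_bound_K: "norm_bound (\<lambda>z. K z w e) (sqrt (onorm (K w w)) * norm e)"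
proof -
  have "kfun [(w, e)] = (\<lambda>z. K z w e)"
    by (rule ext) simp
  then show ?thesis
    using norm_bound_mono[OF norm_bound_kfun sqrt_energy_single] by metis
qed

text \<open>Pair \<open>f\<close> with the single function \<open>K(\<cdot>, w)\<close> applied to
  \<open>f w\<close>: the pairing is the square of \<open>norm (f w)\<close>, and the energy of that
  function is at most \<open>onorm (K w w)\<close> times the same square.\<close>

lemma norm_eval_le:
  assumes "norm_bound f C"
  shows "norm (f w) \<le> C * sqrt (onorm (K w w))"
proof (cases "f w = 0")
  case True
  then show ?thesis
    using assms onorm_pos_le[OF bop_bounded_linear[OF K_in_bop]] by (simp add: norm_bound_def)
next
  case False
  have "norm (f w) * norm (f w) = cmod (pairing f [(w, f w)])"
    by (simp add: ip_self power2_eq_square norm_mult)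
  also have "\<dots> \<le> C * sqrt (energy [(w, f w)])"
    by (rule norm_boundD[OF assms])
  also have "\<dots> \<le> C * (sqrt (onorm (K w w)) * norm (f w))"
    using sqrt_energy_single norm_bound_nonneg[OF assms] by (rule mult_left_mono)
  finally show ?thesis
    using False by simp
qed

text \<open>A pairing with a fixed list uses only finitely many values of the function, so pointwise
  convergence carries the bound over to the limit.\<close>

lemma norm_bound_limit:
  assumes lim: "\<And>z. (\<lambda>n. f n z) \<longlonglongrightarrow> g z"
    and bound: "\<And>n. N \<le> n \<Longrightarrow> norm_bound (f n) C"
  shows "norm_bound g C"
  unfolding norm_bound_def
proof (intro conjI allI)
  show "0 \<le> C" using bound norm_bound_nonneg by blast
  fix l
  have "(\<lambda>n. pairing (f n) l) \<longlonglongrightarrow> pairing g l"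
    by (induction l)
      (auto intro!: tendsto_add bounded_linear.tendsto[OF bounded_linear_ip_left] lim)
  then have "(\<lambda>n. cmod (pairing (f n) l)) \<longlonglongrightarrow> cmod (pairing g l)"
    by (rule tendsto_norm)
  then show "cmod (pairing g l) \<le> C * sqrt (energy l)"
    by (rule LIMSEQ_le_const2) (use bound norm_boundD in blast)
qed

section \<open>The closure of the kernel sums and its inner product\<close>

definition approx :: "('w \<Rightarrow> 'e) \<Rightarrow> bool" where
  "approx g \<longleftrightarrow> (\<forall>\<epsilon>>0. \<exists>l. norm_bound (\<lambda>z. g z - kfun l z) \<epsilon>)"

lemma approx_bounded:
  assumes "approx g"
  shows "\<exists>C. norm_bound g C"
proof -
  obtain l where "norm_bound (\<lambda>z. g z - kfun l z) 1"
    using assms zero_less_one unfolding approx_def by blast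
  from norm_bound_add[OF this norm_bound_kfun[of l]] show ?thesis
    by auto
qed

lemma approx_kfun: "approx (kfun l)"
  unfolding approx_def
  by (intro allI impI exI[of _ l]) (simp add: norm_bound_zero)

text \<open>Two approximants of the same \<open>g\<close> differ by a kernel sum of norm at most
  \<epsilon> + \<delta>, and the difference of the pairings is the pairing with that sum. This gives
  both convergence of the pairings and independence of the approximating sequence.\<close>

lemma cmod_pairing_diff_le:
  assumes f: "norm_bound f C"
    and l: "norm_bound (\<lambda>z. g z - kfun l z) \<epsilon>" and m: "norm_bound (\<lambda>z. g z - kfun m z) \<delta>"
  shows "cmod (pairing f l - pairing f m) \<le> C * (\<epsilon> + \<delta>)"
proof -
  let ?d = "l @ cscale_list (- 1) m"
  have "(\<lambda>z. (g z - kfun m z) - (g z - kfun l z)) = kfun ?d"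
    by (rule ext) (simp add: kfun_append kfun_cscale_list cscale_minus_one)
  with norm_bound_diff[OF m l] have "norm_bound (kfun ?d) (\<delta> + \<epsilon>)"
    by simp
  then have "sqrt (energy ?d) \<le> \<epsilon> + \<delta>"
    using sqrt_energy_le by fastforce
  moreover have "cmod (pairing f l - pairing f m) \<le> C * sqrt (energy ?d)"
    using norm_boundD[OF f, of ?d] by (simp add: pairing_append pairing_cscale_list)
  ultimately show ?thesis
    using norm_bound_nonneg[OF f] by (meson mult_left_mono order_trans)
qed

text \<open>The value is pinned down by an error estimate against every approximant and every bound
  of \<open>f\<close>, instead of as the limit along a chosen sequence. Letting \<epsilon> tend to 0
  shows that at most one \<open>b\<close> satisfies it.\<close>

lemma form_exists:
  assumes g: "approx g" and f: "norm_bound f C"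
  shows "\<exists>b. \<forall>C l \<epsilon>. norm_bound f C \<longrightarrow> norm_bound (\<lambda>z. g z - kfun l z) \<epsilon> \<longrightarrow>
    cmod (b - pairing f l) \<le> C * \<epsilon>"
proof -
  have "\<exists>l. norm_bound (\<lambda>z. g z - kfun l z) (1 / real (Suc n))" for n
    using g unfolding approx_def by (meson of_nat_0_less_iff zero_less_Suc zero_less_divide_1_iff)
  then obtain s where s: "\<And>n. norm_bound (\<lambda>z. g z - kfun (s n) z) (1 / real (Suc n))"
    by metis
  have inv: "(\<lambda>n. 1 / real (Suc n)) \<longlonglongrightarrow> 0"
    by (rule LIMSEQ_Suc[OF lim_1_over_n])
  have "Cauchy (\<lambda>n. pairing f (s n))"
  proof (rule metric_CauchyI)
    fix e :: real assume e: "0 < e"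
    have "\<forall>\<^sub>F n in sequentially. C * (1 / real (Suc n)) < e / 2"
      by (rule order_tendstoD(2)[OF tendsto_mult_right_zero[OF inv]]) (use e in simp)
    then obtain M where M: "\<And>n. M \<le> n \<Longrightarrow> C * (1 / real (Suc n)) < e / 2"
      by (auto simp: eventually_sequentially)
    have "dist (pairing f (s n)) (pairing f (s k)) < e" if "M \<le> n" "M \<le> k" for n k
      using cmod_pairing_diff_le[OF f s[of n] s[of k]] M[OF that(1)] M[OF that(2)]
      unfolding dist_norm distrib_left by linarith
    then show "\<exists>M. \<forall>n\<ge>M. \<forall>k\<ge>M. dist (pairing f (s n)) (pairing f (s k)) < e"
      by blast
  qed
  then obtain b where b: "(\<lambda>n. pairing f (s n)) \<longlonglongrightarrow> b"
    using Cauchy_convergent convergent_def by blast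
  have "cmod (b - pairing f l) \<le> D * \<epsilon>"
    if D: "norm_bound f D" and l: "norm_bound (\<lambda>z. g z - kfun l z) \<epsilon>" for D l \<epsilon>
  proof -
    have "(\<lambda>n. cmod (pairing f (s n) - pairing f l)) \<longlonglongrightarrow> cmod (b - pairing f l)"
      by (intro tendsto_intros b)
    moreover have "(\<lambda>n. D * (1 / real (Suc n) + \<epsilon>)) \<longlonglongrightarrow> D * (0 + \<epsilon>)"
      by (intro tendsto_mult tendsto_add tendsto_const inv)
    ultimately have "cmod (b - pairing f l) \<le> D * (0 + \<epsilon>)"
      by (rule LIMSEQ_le) (use cmod_pairing_diff_le[OF D s l] in blast)
    then show ?thesis by simp
  qed
  then show ?thesis by blast
qed

definition form :: "('w \<Rightarrow> 'e) \<Rightarrow> ('w \<Rightarrow> 'e) \<Rightarrow> complex" where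
  "form f g = (SOME b. \<forall>C l \<epsilon>. norm_bound f C \<longrightarrow> norm_bound (\<lambda>z. g z - kfun l z) \<epsilon> \<longrightarrow>
    cmod (b - pairing f l) \<le> C * \<epsilon>)"

lemma form_approx:
  assumes "approx g" "norm_bound f C" "norm_bound (\<lambda>z. g z - kfun l z) \<epsilon>"
  shows "cmod (form f g - pairing f l) \<le> C * \<epsilon>"
  using someI_ex[OF form_exists[OF assms(1,2)]] assms(2,3) unfolding form_def by blast

text \<open>The list \<open>l\<close> approximates \<open>kfun l\<close> with error 0, so the
  defining estimate becomes an equality.\<close>

lemma form_kfun:
  assumes "norm_bound f C"
  shows "form f (kfun l) = pairing f l"
  using form_approx[OF approx_kfun assms, of l l 0] by (simp add: norm_bound_zero)

text \<open>One sequence works for all \<open>f\<close> simultaneously, so every identity between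
  pairings in the first argument passes to \<open>form\<close>.\<close>

lemma approx_sequence:
  assumes g: "approx g"
  shows "\<exists>s. (\<forall>n. norm_bound (\<lambda>z. g z - kfun (s n) z) (1 / real (Suc n))) \<and>
    (\<forall>f C. norm_bound f C \<longrightarrow> (\<lambda>n. pairing f (s n)) \<longlonglongrightarrow> form f g)"
proof -
  have "\<exists>l. norm_bound (\<lambda>z. g z - kfun l z) (1 / real (Suc n))" for n
    using g unfolding approx_def by (meson of_nat_0_less_iff zero_less_Suc zero_less_divide_1_iff)
  then obtain s where s: "\<And>n. norm_bound (\<lambda>z. g z - kfun (s n) z) (1 / real (Suc n))"
    by metis
  have "(\<lambda>n. pairing f (s n)) \<longlonglongrightarrow> form f g" if f: "norm_bound f C" for f C
  proof (rule LIM_zero_cancel, rule tendsto_norm_zero_cancel, rule tendsto_sandwich)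
    show "\<forall>\<^sub>F n in sequentially. 0 \<le> cmod (pairing f (s n) - form f g)"
      by simp
    show "\<forall>\<^sub>F n in sequentially. cmod (pairing f (s n) - form f g) \<le> C * (1 / real (Suc n))"
      using form_approx[OF g f s] by (simp add: norm_minus_commute)
    show "(\<lambda>n. C * (1 / real (Suc n))) \<longlonglongrightarrow> 0"
      by (intro tendsto_mult_right_zero LIMSEQ_Suc[OF lim_1_over_n])
  qed simp
  with s show ?thesis by blast
qed

lemma sqrt_energy_approx_le:
  assumes f: "norm_bound f C" and l: "norm_bound (\<lambda>z. f z - kfun l z) \<epsilon>"
  shows "sqrt (energy l) \<le> C + \<epsilon>"
  using sqrt_energy_le norm_bound_diff[OF f l] by simp

lemma form_add_left:
  assumes "norm_bound f C" "norm_bound g D" "approx h"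
  shows "form (\<lambda>z. f z + g z) h = form f h + form g h"
proof -
  obtain s where s: "\<And>f C. norm_bound f C \<Longrightarrow> (\<lambda>n. pairing f (s n)) \<longlonglongrightarrow> form f h"
    using approx_sequence[OF assms(3)] by blast
  show ?thesis
    using s[OF norm_bound_add[OF assms(1,2)]] tendsto_add[OF s[OF assms(1)] s[OF assms(2)]]
    by (auto simp: pairing_add intro: LIMSEQ_unique)
qed

lemma form_cscale_left:
  assumes "norm_bound f C" "approx h"
  shows "form (\<lambda>z. cscale J c (f z)) h = c * form f h"
proof -
  obtain s where s: "\<And>f C. norm_bound f C \<Longrightarrow> (\<lambda>n. pairing f (s n)) \<longlonglongrightarrow> form f h"
    using approx_sequence[OF assms(2)] by blast
  show ?thesis
    using s[OF norm_bound_cscale[OF assms(1)]] tendsto_mult_left[OF s[OF assms(1)], of c]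
    by (auto simp: pairing_cscale intro: LIMSEQ_unique)
qed

text \<open>Both arguments are replaced by kernel sums, where symmetry is known; each replacement
  costs a multiple of \<open>1 / real (Suc n)\<close>.\<close>

lemma form_hermitian:
  assumes f: "approx f" and g: "approx g"
  shows "form f g = cnj (form g f)"
proof -
  obtain C D where C: "norm_bound f C" and D: "norm_bound g D"
    using approx_bounded f g by blast
  obtain s where s: "\<And>n. norm_bound (\<lambda>z. g z - kfun (s n) z) (1 / real (Suc n))"
    and fs: "(\<lambda>n. pairing f (s n)) \<longlonglongrightarrow> form f g"
    using approx_sequence[OF g] C by blast
  obtain t where t: "\<And>n. norm_bound (\<lambda>z. f z - kfun (t n) z) (1 / real (Suc n))"
    and gt: "(\<lambda>n. pairing g (t n)) \<longlonglongrightarrow> form g f"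
    using approx_sequence[OF f] D by blast
  \<comment> \<open>The constant is \<open>(D + 1) + (C + 1)\<close>: the approximants of
    \<open>g\<close> and \<open>f\<close> have norms at most \<open>D + 1\<close> and
    \<open>C + 1\<close>, because all errors are at most 1.\<close>
  have le: "cmod (pairing f (s n) - cnj (pairing g (t n))) \<le> (C + D + 2) * (1 / real (Suc n))" for n
  proof -
    let ?e = "1 / real (Suc n)"
    have e: "?e \<le> 1" by simp
    have "cmod (pairing f (s n) - pairing (kfun (t n)) (s n)) \<le> ?e * sqrt (energy (s n))"
      using norm_boundD[OF t[of n], of "s n"] by (simp only: pairing_diff)
    also have "\<dots> \<le> ?e * (D + 1)"
      using sqrt_energy_approx_le[OF D s[of n]] e by (intro mult_left_mono, linarith) simp
    finally have 1: "cmod (pairing f (s n) - pairing (kfun (t n)) (s n)) \<le> ?e * (D + 1)" .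
    have "cmod (pairing g (t n) - pairing (kfun (s n)) (t n)) \<le> ?e * sqrt (energy (t n))"
      using norm_boundD[OF s[of n], of "t n"] by (simp only: pairing_diff)
    also have "\<dots> \<le> ?e * (C + 1)"
      using sqrt_energy_approx_le[OF C t[of n]] e by (intro mult_left_mono, linarith) simp
    finally have "cmod (cnj (pairing g (t n) - pairing (kfun (s n)) (t n))) \<le> ?e * (C + 1)"
      by (simp only: complex_mod_cnj)
    then have 2: "cmod (pairing (kfun (t n)) (s n) - cnj (pairing g (t n))) \<le> ?e * (C + 1)"
      using pairing_kfun_hermitian[of "t n" "s n"] by (simp add: norm_minus_commute)
    show ?thesis
      using norm_diff_triangle_le[OF 1 2] by (simp only: algebra_simps)
  qed
  have "(\<lambda>n. (C + D + 2) * (1 / real (Suc n))) \<longlonglongrightarrow> 0"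
    by (intro tendsto_mult_right_zero LIMSEQ_Suc[OF lim_1_over_n])
  then have lim0: "(\<lambda>n. pairing f (s n) - cnj (pairing g (t n))) \<longlonglongrightarrow> 0"
    by (rule Lim_null_comparison[OF always_eventually[OF allI[OF le]]])
  have "(\<lambda>n. pairing f (s n) - cnj (pairing g (t n))) \<longlonglongrightarrow> form f g - cnj (form g f)"
    by (intro tendsto_intros fs gt)
  from LIMSEQ_unique[OF this lim0] show ?thesis
    by (simp only: right_minus_eq)
qed

lemma form_add_right:
  assumes "approx f" "approx g" "approx h" "approx (\<lambda>z. g z + h z)"
  shows "form f (\<lambda>z. g z + h z) = form f g + form f h"
proof -
  obtain C D where "norm_bound g C" "norm_bound h D"
    using approx_bounded assms by blast
  then show ?thesis
    using form_add_left[OF _ _ assms(1)] assms by (simp add: form_hermitian[of f])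
qed

lemma form_cscale_right:
  assumes "approx f" "approx g" "approx (\<lambda>z. cscale J c (g z))"
  shows "form f (\<lambda>z. cscale J c (g z)) = cnj c * form f g"
proof -
  obtain C where "norm_bound g C"
    using approx_bounded assms by blast
  then show ?thesis
    using form_cscale_left[OF _ assms(1)] assms by (simp add: form_hermitian[of f])
qed

lemma energy_tendsto_form:
  assumes f: "approx f" and s: "\<And>n. norm_bound (\<lambda>z. f z - kfun (s n) z) (1 / real (Suc n))"
  shows "(\<lambda>n. complex_of_real (energy (s n))) \<longlonglongrightarrow> form f f"
proof -
  obtain C where C: "norm_bound f C"
    using approx_bounded f by blast
  \<comment> \<open>\<open>pairing f (s n)\<close> is inserted in between: the distance to the
    energy contributes \<open>C + 1\<close>, the distance to \<open>form f f\<close> contributes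
    \<open>C\<close>.\<close>
  have le: "cmod (complex_of_real (energy (s n)) - form f f) \<le> (2 * C + 1) * (1 / real (Suc n))" for n
  proof -
    let ?e = "1 / real (Suc n)"
    have e: "?e \<le> 1" by simp
    have "cmod (pairing f (s n) - pairing (kfun (s n)) (s n)) \<le> ?e * sqrt (energy (s n))"
      using norm_boundD[OF s[of n], of "s n"] by (simp only: pairing_diff)
    also have "\<dots> \<le> ?e * (C + 1)"
      using sqrt_energy_approx_le[OF C s[of n]] e by (intro mult_left_mono, linarith) simp
    finally have 1: "cmod (complex_of_real (energy (s n)) - pairing f (s n)) \<le> ?e * (C + 1)"
      by (simp add: pairing_kfun_self norm_minus_commute)
    have 2: "cmod (pairing f (s n) - form f f) \<le> C * ?e"
      using form_approx[OF f C s[of n]] by (simp only: norm_minus_commute)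
    have "e * (C + 1) + C * e = (2 * C + 1) * e" for e :: real
      by algebra
    with norm_diff_triangle_le[OF 1 2] show ?thesis
      by (simp only:)
  qed
  have "(\<lambda>n. (2 * C + 1) * (1 / real (Suc n))) \<longlonglongrightarrow> 0"
    by (intro tendsto_mult_right_zero LIMSEQ_Suc[OF lim_1_over_n])
  then have "(\<lambda>n. complex_of_real (energy (s n)) - form f f) \<longlonglongrightarrow> 0"
    by (rule Lim_null_comparison[OF always_eventually[OF allI[OF le]]])
  then show ?thesis
    by (rule LIM_zero_cancel)
qed

lemma cnonneg_form:
  assumes f: "approx f"
  shows "cnonneg (form f f)"
proof -
  obtain s where "\<And>n. norm_bound (\<lambda>z. f z - kfun (s n) z) (1 / real (Suc n))"
    using approx_sequence[OF f] by blast
  then have *: "(\<lambda>n. complex_of_real (energy (s n))) \<longlonglongrightarrow> form f f"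
    by (rule energy_tendsto_form[OF f])
  have "0 \<le> Re (form f f)"
    by (rule LIMSEQ_le_const[OF tendsto_Re[OF *]]) simp
  moreover have "(\<lambda>n. 0) \<longlonglongrightarrow> Im (form f f)"
    using tendsto_Im[OF *] by simp
  ultimately show ?thesis
    by (simp add: cnonneg_def LIMSEQ_const_iff)
qed

lemma cmod_form_le:
  assumes f: "norm_bound f C" and g: "approx g" and D: "norm_bound g D"
  shows "cmod (form f g) \<le> C * D"
proof -
  obtain s where s: "\<And>n. norm_bound (\<lambda>z. g z - kfun (s n) z) (1 / real (Suc n))"
    and fs: "(\<lambda>n. pairing f (s n)) \<longlonglongrightarrow> form f g"
    using approx_sequence[OF g] f by blast
  have "cmod (pairing f (s n)) \<le> C * (D + 1 / real (Suc n))" for n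
    using norm_boundD[OF f, of "s n"] sqrt_energy_approx_le[OF D s[of n]] norm_bound_nonneg[OF f]
    by (meson mult_left_mono order_trans)
  moreover have "(\<lambda>n. C * (D + 1 / real (Suc n))) \<longlonglongrightarrow> C * (D + 0)"
    by (intro tendsto_intros LIMSEQ_Suc[OF lim_1_over_n])
  ultimately have "cmod (form f g) \<le> C * (D + 0)"
    by (intro LIMSEQ_le[OF tendsto_norm[OF fs]]) auto
  then show ?thesis by simp
qed

text \<open>Writing \<open>f\<close> as a kernel sum plus a remainder bounds its dual norm by
  \<open>sqrt (energy (s n)) + 1 / real (Suc n)\<close>, which tends to the square root of
  \<open>form f f\<close>. So the dual norm and the norm given by the inner product agree.\<close>

lemma norm_bound_sqrt_form:
  assumes f: "approx f"
  shows "norm_bound f (sqrt (Re (form f f)))"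
proof -
  obtain s where s: "\<And>n. norm_bound (\<lambda>z. f z - kfun (s n) z) (1 / real (Suc n))"
    using approx_sequence[OF f] by blast
  have "(\<lambda>n. energy (s n)) \<longlonglongrightarrow> Re (form f f)"
    using tendsto_Re[OF energy_tendsto_form[OF f s]] by simp
  then have lim: "(\<lambda>n. (sqrt (energy (s n)) + 1 / real (Suc n)) * sqrt (energy l))
      \<longlonglongrightarrow> (sqrt (Re (form f f)) + 0) * sqrt (energy l)" for l
    by (intro tendsto_intros LIMSEQ_Suc[OF lim_1_over_n])
  have "norm_bound f (sqrt (energy (s n)) + 1 / real (Suc n))" for n
    using norm_bound_add[OF norm_bound_kfun[of "s n"] s[of n]] by simp
  then have "cmod (pairing f l) \<le> (sqrt (Re (form f f)) + 0) * sqrt (energy l)" for l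
    by (intro LIMSEQ_le_const[OF lim]) (use norm_boundD in blast)
  then show ?thesis
    using cnonneg_form[OF f] by (simp add: norm_bound_def cnonneg_def)
qed


section \<open>The operator-valued module\<close>

definition eval_list :: "('w \<times> ('e \<Rightarrow> 'e)) list \<Rightarrow> 'e \<Rightarrow> ('w \<times> 'e) list" where
  "eval_list ms x = map (\<lambda>(w, b). (w, b x)) ms"

text \<open>Says that \<open>x \<mapsto> F(\<cdot>)x\<close>, as an operator into the reproducing
  kernel Hilbert space, has norm at most \<open>C\<close>.\<close>

definition module_bound :: "('w \<Rightarrow> 'e \<Rightarrow> 'e) \<Rightarrow> real \<Rightarrow> bool" where
  "module_bound F C \<longleftrightarrow> 0 \<le> C \<and> (\<forall>x. norm_bound (\<lambda>z. F z x) (C * norm x))"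

definition rk_module :: "('w \<Rightarrow> 'e \<Rightarrow> 'e) set" where
  "rk_module = {F. (\<forall>z. F z \<in> bop J) \<and>
     (\<forall>\<epsilon>>0. \<exists>ms. snd ` set ms \<subseteq> bop J \<and> module_bound (\<lambda>z x. F z x - kfun (eval_list ms x) z) \<epsilon>)}"

text \<open>With \<open>F\<close> and \<open>G\<close> read as operators into the reproducing kernel
  Hilbert space, this is the adjoint of \<open>G\<close> composed with \<open>F\<close>; the
  description is used for members of \<open>rk_module\<close>, where Riesz provides the
  vector.\<close>

definition rk_ip :: "('w \<Rightarrow> 'e \<Rightarrow> 'e) \<Rightarrow> ('w \<Rightarrow> 'e \<Rightarrow> 'e) \<Rightarrow> 'e \<Rightarrow> 'e" where
  "rk_ip F G x = (THE u. \<forall>y. ip u y = form (\<lambda>z. F z x) (\<lambda>z. G z y))"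

lemma eval_list_Nil [simp]: "eval_list [] x = []"
  by (simp add: eval_list_def)

lemma eval_list_Cons [simp]: "eval_list ((w, b) # ms) x = (w, b x) # eval_list ms x"
  by (simp add: eval_list_def)

lemma eval_list_append: "eval_list (ms @ ns) x = eval_list ms x @ eval_list ns x"
  by (simp add: eval_list_def)

lemma module_bound_nonneg: "module_bound F C \<Longrightarrow> 0 \<le> C"
  by (simp add: module_bound_def)

lemma module_boundD: "module_bound F C \<Longrightarrow> norm_bound (\<lambda>z. F z x) (C * norm x)"
  by (simp add: module_bound_def)

lemma module_bound_mono: "module_bound F C \<Longrightarrow> C \<le> D \<Longrightarrow> module_bound F D"
  unfolding module_bound_def by (meson mult_right_mono norm_bound_mono norm_ge_zero order_trans)

lemma module_bound_add:
  "module_bound F C \<Longrightarrow> module_bound G D \<Longrightarrow> module_bound (\<lambda>z x. F z x + G z x) (C + D)"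
  unfolding module_bound_def by (simp add: norm_bound_add distrib_right)

lemma module_bound_cscale:
  "module_bound F C \<Longrightarrow> module_bound (\<lambda>z x. cscale J c (F z x)) (cmod c * C)"
  unfolding module_bound_def by (simp add: norm_bound_cscale mult.assoc)

lemma module_bound_comp:
  assumes F: "module_bound F C" and b: "b \<in> bop J"
  shows "module_bound (\<lambda>z x. F z (b x)) (C * onorm b)"
proof -
  have "C * norm (b x) \<le> C * onorm b * norm x" for x
    using mult_left_mono[OF onorm[OF bop_bounded_linear[OF b], of x] module_bound_nonneg[OF F]]
    by (simp add: mult.assoc)
  then show ?thesis
    using F onorm_pos_le[OF bop_bounded_linear[OF b]] norm_bound_mono
    unfolding module_bound_def by (metis mult_nonneg_nonneg)
qed

lemma module_bound_zero: "0 \<le> C \<Longrightarrow> module_bound (\<lambda>z x. 0) C"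
  by (simp add: module_bound_def norm_bound_zero)

lemma module_bound_K: "module_bound (\<lambda>z. K z w) (sqrt (onorm (K w w)))"
  using onorm_pos_le[OF bop_bounded_linear[OF K_in_bop]] norm_bound_K
  by (simp add: module_bound_def)

lemma module_bound_eval_list:
  assumes "snd ` set ms \<subseteq> bop J"
  shows "\<exists>C. module_bound (\<lambda>z x. kfun (eval_list ms x) z) C"
  using assms
proof (induction ms)
  case Nil
  then show ?case using module_bound_zero[of 0] by auto
next
  case (Cons p ms)
  obtain w b where p: "p = (w, b)" by fastforce
  from Cons obtain C where "module_bound (\<lambda>z x. kfun (eval_list ms x) z) C"
    by auto
  moreover have "b \<in> bop J"
    using Cons.prems p by simp
  ultimately have "module_bound (\<lambda>z x. K z w (b x) + kfun (eval_list ms x) z)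
      (sqrt (onorm (K w w)) * onorm b + C)"
    by (intro module_bound_add module_bound_comp[OF module_bound_K])
  then show ?case by (auto simp: p)
qed

section \<open>Members of the module and closure under its operations\<close>

lemma rk_module_bop: "F \<in> rk_module \<Longrightarrow> F z \<in> bop J"
  by (simp add: rk_module_def)

lemma rk_module_approx:
  assumes "F \<in> rk_module" "0 < \<epsilon>"
  obtains ms where "snd ` set ms \<subseteq> bop J" "module_bound (\<lambda>z x. F z x - kfun (eval_list ms x) z) \<epsilon>"
  using assms unfolding rk_module_def by blast

lemma rk_moduleI:
  assumes "\<And>z. F z \<in> bop J"
    and "\<And>\<epsilon>. 0 < \<epsilon> \<Longrightarrow> \<exists>ms. snd ` set ms \<subseteq> bop J \<and> module_bound (\<lambda>z x. F z x - kfun (eval_list ms x) z) \<epsilon>"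
  shows "F \<in> rk_module"
  using assms unfolding rk_module_def by blast

lemma rk_module_bounded:
  assumes "F \<in> rk_module"
  shows "\<exists>C. module_bound F C"
proof -
  obtain ms where "snd ` set ms \<subseteq> bop J" and ms: "module_bound (\<lambda>z x. F z x - kfun (eval_list ms x) z) 1"
    using rk_module_approx[OF assms zero_less_one] by blast
  then obtain C where "module_bound (\<lambda>z x. kfun (eval_list ms x) z) C"
    using module_bound_eval_list by blast
  from module_bound_add[OF ms this] show ?thesis by auto
qed

lemma approx_rk_module:
  assumes "F \<in> rk_module"
  shows "approx (\<lambda>z. F z x)"
  unfolding approx_def
proof (intro allI impI)
  fix \<epsilon> :: real assume \<epsilon>: "0 < \<epsilon>"
  \<comment> \<open>The added 1 keeps the denominator positive for \<open>x = 0\<close>.\<close>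
  then have "0 < \<epsilon> / (norm x + 1)"
    by (simp add: add_nonneg_pos)
  then obtain ms where "module_bound (\<lambda>z x. F z x - kfun (eval_list ms x) z) (\<epsilon> / (norm x + 1))"
    using rk_module_approx[OF assms] by blast
  from module_boundD[OF this, of x]
  have "norm_bound (\<lambda>z. F z x - kfun (eval_list ms x) z) (\<epsilon> / (norm x + 1) * norm x)" .
  moreover have "\<epsilon> / (norm x + 1) * norm x \<le> \<epsilon>"
    using \<epsilon> by (simp add: pos_divide_le_eq add_nonneg_pos)
  ultimately show "\<exists>l. norm_bound (\<lambda>z. F z x - kfun l z) \<epsilon>"
    using norm_bound_mono by blast
qed

lemma rk_module_zero: "(\<lambda>z x. 0) \<in> rk_module"
  by (rule rk_moduleI) (auto intro!: exI[of _ "[]"] simp: zero_in_bop module_bound_zero)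

lemma rk_module_add:
  assumes F: "F \<in> rk_module" and G: "G \<in> rk_module"
  shows "(\<lambda>z x. F z x + G z x) \<in> rk_module"
proof (rule rk_moduleI)
  show "(\<lambda>x. F z x + G z x) \<in> bop J" for z
    by (intro add_in_bop rk_module_bop F G)
  fix \<epsilon> :: real assume \<epsilon>: "0 < \<epsilon>"
  then have \<epsilon>2: "0 < \<epsilon> / 2" by simp
  obtain ms where ms: "snd ` set ms \<subseteq> bop J"
    "module_bound (\<lambda>z x. F z x - kfun (eval_list ms x) z) (\<epsilon> / 2)"
    by (rule rk_module_approx[OF F \<epsilon>2])
  obtain ns where ns: "snd ` set ns \<subseteq> bop J"
    "module_bound (\<lambda>z x. G z x - kfun (eval_list ns x) z) (\<epsilon> / 2)"
    by (rule rk_module_approx[OF G \<epsilon>2])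
  have "snd ` set (ms @ ns) \<subseteq> bop J"
    using ms(1) ns(1) by auto
  moreover have "module_bound (\<lambda>z x. F z x + G z x - kfun (eval_list (ms @ ns) x) z) \<epsilon>"
    using module_bound_add[OF ms(2) ns(2)]
    by (simp add: eval_list_append kfun_append add_diff_add)
  ultimately show "\<exists>ms. snd ` set ms \<subseteq> bop J \<and>
      module_bound (\<lambda>z x. F z x + G z x - kfun (eval_list ms x) z) \<epsilon>"
    by blast
qed

lemma rk_module_cscale:
  assumes F: "F \<in> rk_module"
  shows "(\<lambda>z x. cscale J c (F z x)) \<in> rk_module"
proof (rule rk_moduleI)
  show "(\<lambda>x. cscale J c (F z x)) \<in> bop J" for z
    by (intro comp_in_bop[OF cscale_in_bop] rk_module_bop F)
  fix \<epsilon> :: real assume \<epsilon>: "0 < \<epsilon>"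
  have "0 < \<epsilon> / (cmod c + 1)"
    using \<epsilon> by (simp add: add_nonneg_pos)
  then obtain ms where ms: "snd ` set ms \<subseteq> bop J"
    and b: "module_bound (\<lambda>z x. F z x - kfun (eval_list ms x) z) (\<epsilon> / (cmod c + 1))"
    by (rule rk_module_approx[OF F])
  let ?ns = "map (\<lambda>(w, b). (w, \<lambda>x. cscale J c (b x))) ms"
  have ev: "eval_list ?ns x = cscale_list c (eval_list ms x)" for x
    by (simp add: eval_list_def cscale_list_def case_prod_beta)
  have "snd ` set ?ns \<subseteq> bop J"
    using ms comp_in_bop[OF cscale_in_bop] by force
  moreover have diff: "cscale J c (u - v) = cscale J c u - cscale J c v" for u v
    by (rule linear_diff[OF bounded_linear.linear[OF bounded_linear_cscale]])
  have "cmod c * (\<epsilon> / (cmod c + 1)) \<le> \<epsilon>"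
    using \<epsilon> by (simp add: pos_divide_le_eq add_nonneg_pos)
  then have "module_bound (\<lambda>z x. cscale J c (F z x - kfun (eval_list ms x) z)) \<epsilon>"
    by (rule module_bound_mono[OF module_bound_cscale[OF b]])
  then have "module_bound (\<lambda>z x. cscale J c (F z x) - kfun (eval_list ?ns x) z) \<epsilon>"
    by (simp only: ev kfun_cscale_list diff)
  ultimately show "\<exists>ms. snd ` set ms \<subseteq> bop J \<and>
      module_bound (\<lambda>z x. cscale J c (F z x) - kfun (eval_list ms x) z) \<epsilon>"
    by blast
qed

lemma rk_module_diff:
  assumes F: "F \<in> rk_module" and G: "G \<in> rk_module"
  shows "(\<lambda>z x. F z x - G z x) \<in> rk_module"
  using rk_module_add[OF F rk_module_cscale[OF G, of "- 1"]] by (simp add: cscale_minus_one)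

text \<open>Right multiplication by \<open>b\<close> is absorbed into the coefficients of an
  approximating sum and multiplies the error by at most \<open>onorm b\<close>.\<close>

lemma rk_module_comp:
  assumes F: "F \<in> rk_module" and b: "b \<in> bop J"
  shows "(\<lambda>z x. F z (b x)) \<in> rk_module"
proof (rule rk_moduleI)
  show "(\<lambda>x. F z (b x)) \<in> bop J" for z
    by (rule comp_in_bop[OF rk_module_bop[OF F] b])
  fix \<epsilon> :: real assume \<epsilon>: "0 < \<epsilon>"
  have o: "0 \<le> onorm b"
    by (rule onorm_pos_le[OF bop_bounded_linear[OF b]])
  then have "0 < \<epsilon> / (onorm b + 1)"
    using \<epsilon> by (simp add: add_nonneg_pos)
  then obtain ms where ms: "snd ` set ms \<subseteq> bop J"
    and *: "module_bound (\<lambda>z x. F z x - kfun (eval_list ms x) z) (\<epsilon> / (onorm b + 1))"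
    by (rule rk_module_approx[OF F])
  let ?ns = "map (\<lambda>(w, a). (w, \<lambda>x. a (b x))) ms"
  have ev: "eval_list ?ns x = eval_list ms (b x)" for x
    by (simp add: eval_list_def case_prod_beta)
  have "snd ` set ?ns \<subseteq> bop J"
    using ms comp_in_bop[OF _ b] by force
  moreover have "\<epsilon> / (onorm b + 1) * onorm b \<le> \<epsilon>"
    using \<epsilon> o by (simp add: pos_divide_le_eq add_nonneg_pos)
  then have "module_bound (\<lambda>z x. F z (b x) - kfun (eval_list ?ns x) z) \<epsilon>"
    using module_bound_mono[OF module_bound_comp[OF * b]] by (simp only: ev)
  ultimately show "\<exists>ms. snd ` set ms \<subseteq> bop J \<and>
      module_bound (\<lambda>z x. F z (b x) - kfun (eval_list ms x) z) \<epsilon>"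
    by blast
qed

lemma rk_module_K: "(\<lambda>z. K z w) \<in> rk_module"
  by (rule rk_moduleI)
    (auto intro!: exI[of _ "[(w, \<lambda>x. x)]"] simp: K_in_bop id_in_bop module_bound_zero)

section \<open>The operator-valued inner product and its norm\<close>

lemma norm_bound_rk_module:
  assumes "F \<in> rk_module"
  shows "\<exists>C. norm_bound (\<lambda>z. F z x) C"
  using rk_module_bounded[OF assms] module_boundD by blast

lemma form_rk_module_le:
  assumes F: "F \<in> rk_module" and G: "G \<in> rk_module"
    and C: "module_bound F C" and D: "module_bound G D"
  shows "cmod (form (\<lambda>z. F z x) (\<lambda>z. G z y)) \<le> C * D * norm x * norm y"
  using cmod_form_le[OF module_boundD[OF C] approx_rk_module[OF G] module_boundD[OF D]]
  by (simp add: mult_ac)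

lemma ip_rk_ip:
  assumes F: "F \<in> rk_module" and G: "G \<in> rk_module"
  shows "ip (rk_ip F G x) y = form (\<lambda>z. F z x) (\<lambda>z. G z y)"
proof -
  note G' = approx_rk_module[OF G]
  obtain C D where C: "module_bound F C" and D: "module_bound G D"
    using rk_module_bounded F G by blast
  have add: "(\<lambda>z. G z (y + y')) = (\<lambda>z. G z y + G z y')" for y y'
    by (rule ext) (rule bop_add[OF rk_module_bop[OF G]])
  have cscale: "(\<lambda>z. G z (cscale J c y)) = (\<lambda>z. cscale J c (G z y))" for c y
    by (rule ext) (rule bop_cscale_apply[OF rk_module_bop[OF G]])
  have "\<exists>u. \<forall>y. ip u y = form (\<lambda>z. F z x) (\<lambda>z. G z y)"
  proof (rule riesz)
    fix y y' c
    show "form (\<lambda>z. F z x) (\<lambda>z. G z (y + y')) =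
        form (\<lambda>z. F z x) (\<lambda>z. G z y) + form (\<lambda>z. F z x) (\<lambda>z. G z y')"
      unfolding add by (rule form_add_right[OF approx_rk_module[OF F] G' G' G'[of "y + y'", unfolded add]])
    show "form (\<lambda>z. F z x) (\<lambda>z. G z (cscale J c y)) = cnj c * form (\<lambda>z. F z x) (\<lambda>z. G z y)"
      unfolding cscale
      by (rule form_cscale_right[OF approx_rk_module[OF F] G' G'[of "cscale J c y", unfolded cscale]])
    show "cmod (form (\<lambda>z. F z x) (\<lambda>z. G z y)) \<le> C * D * norm x * norm y"
      by (rule form_rk_module_le[OF F G C D])
  qed
  then obtain u where u: "\<forall>y. ip u y = form (\<lambda>z. F z x) (\<lambda>z. G z y)" ..
  then have "rk_ip F G x = u"
    unfolding rk_ip_def by (intro the_equality) (auto intro: ip_eqI)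
  with u show ?thesis by simp
qed

lemma norm_rk_ip_le:
  assumes F: "F \<in> rk_module" and G: "G \<in> rk_module"
    and C: "module_bound F C" and D: "module_bound G D"
  shows "norm (rk_ip F G x) \<le> C * D * norm x"
proof (rule norm_le_if_ip_le)
  show "0 \<le> C * D * norm x"
    using module_bound_nonneg C D by simp
  show "cmod (ip (rk_ip F G x) y) \<le> C * D * norm x * norm y" for y
    using form_rk_module_le[OF F G C D] by (simp add: ip_rk_ip[OF F G])
qed

lemma form_rk_module_arg:
  assumes F: "F \<in> rk_module" and G: "G \<in> rk_module"
  shows "form (\<lambda>z. F z (x + x')) (\<lambda>z. G z y) = form (\<lambda>z. F z x) (\<lambda>z. G z y) + form (\<lambda>z. F z x') (\<lambda>z. G z y)"
    and "form (\<lambda>z. F z (cscale J c x)) (\<lambda>z. G z y) = c * form (\<lambda>z. F z x) (\<lambda>z. G z y)"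
proof -
  obtain C C' where C: "norm_bound (\<lambda>z. F z x) C" "norm_bound (\<lambda>z. F z x') C'"
    using norm_bound_rk_module[OF F] by blast
  show "form (\<lambda>z. F z (x + x')) (\<lambda>z. G z y) = form (\<lambda>z. F z x) (\<lambda>z. G z y) + form (\<lambda>z. F z x') (\<lambda>z. G z y)"
    using form_add_left[OF C approx_rk_module[OF G]] by (simp add: bop_add[OF rk_module_bop[OF F]])
  show "form (\<lambda>z. F z (cscale J c x)) (\<lambda>z. G z y) = c * form (\<lambda>z. F z x) (\<lambda>z. G z y)"
    using form_cscale_left[OF C(1) approx_rk_module[OF G]]
    by (simp add: bop_cscale_apply[OF rk_module_bop[OF F]])
qed

lemma rk_ip_in_bop:
  assumes F: "F \<in> rk_module" and G: "G \<in> rk_module"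
  shows "rk_ip F G \<in> bop J"
proof -
  obtain C D where C: "module_bound F C" and D: "module_bound G D"
    using rk_module_bounded F G by blast
  have cscale: "rk_ip F G (cscale J c x) = cscale J c (rk_ip F G x)" for c x
    by (rule ip_eqI) (simp add: ip_cscale_left ip_rk_ip[OF F G] form_rk_module_arg[OF F G])
  have "bounded_linear (rk_ip F G)"
  proof (rule bounded_linear_intro)
    show "rk_ip F G (x + y) = rk_ip F G x + rk_ip F G y" for x y
      by (rule ip_eqI) (simp add: ip_add_left ip_rk_ip[OF F G] form_rk_module_arg[OF F G])
    show "rk_ip F G (r *\<^sub>R x) = r *\<^sub>R rk_ip F G x" for r x
      using cscale[of "complex_of_real r" x] by (simp only: cscale_of_real)
    show "norm (rk_ip F G x) \<le> norm x * (C * D)" for x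
      using norm_rk_ip_le[OF F G C D, of x] by (simp only: mult.commute)
  qed
  then show ?thesis
    using cscale[of \<i>] by (simp add: bop_def cscale_ii)
qed

lemma hm_norm_le:
  assumes F: "F \<in> rk_module" and C: "module_bound F C"
  shows "hm_norm rk_ip F \<le> C"
proof -
  have "onorm (rk_ip F F) \<le> C * C"
    by (rule onorm_bound) (use norm_rk_ip_le[OF F F C C] module_bound_nonneg[OF C] in simp_all)
  then have "sqrt (onorm (rk_ip F F)) \<le> sqrt (C * C)"
    by (rule real_sqrt_le_mono)
  then show ?thesis
    using module_bound_nonneg[OF C] by (simp add: hm_norm_def)
qed

text \<open>The squared Hilbert space norm of \<open>F(\<cdot>)x\<close> is
  \<open>ip (rk_ip F F x) x\<close>, hence at most \<open>onorm (rk_ip F F)\<close> times the square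
  of \<open>norm x\<close>. Together with \<open>hm_norm_le\<close>, the module norm is the operator
  norm into the reproducing kernel Hilbert space.\<close>

lemma module_bound_hm_norm:
  assumes F: "F \<in> rk_module"
  shows "module_bound F (hm_norm rk_ip F)"
  unfolding module_bound_def
proof (intro conjI allI)
  have bl: "bounded_linear (rk_ip F F)"
    by (intro bop_bounded_linear rk_ip_in_bop F)
  show "0 \<le> hm_norm rk_ip F"
    by (simp add: hm_norm_def onorm_pos_le[OF bl])
  fix x
  have "Re (form (\<lambda>z. F z x) (\<lambda>z. F z x)) \<le> norm (rk_ip F F x) * norm x"
    using cmod_ip_le[of "rk_ip F F x" x] complex_Re_le_cmod[of "ip (rk_ip F F x) x"]
    by (simp add: ip_rk_ip[OF F F])
  also have "\<dots> \<le> onorm (rk_ip F F) * norm x * norm x"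
    by (intro mult_right_mono onorm[OF bl]) simp
  finally have "sqrt (Re (form (\<lambda>z. F z x) (\<lambda>z. F z x))) \<le> sqrt (onorm (rk_ip F F) * (norm x)\<^sup>2)"
    by (intro real_sqrt_le_mono) (simp add: power2_eq_square mult.assoc)
  then have "sqrt (Re (form (\<lambda>z. F z x) (\<lambda>z. F z x))) \<le> hm_norm rk_ip F * norm x"
    by (simp add: hm_norm_def real_sqrt_mult)
  with norm_bound_sqrt_form[OF approx_rk_module[OF F]]
  show "norm_bound (\<lambda>z. F z x) (hm_norm rk_ip F * norm x)"
    by (rule norm_bound_mono)
qed

text \<open>Evaluation is bounded, so a Cauchy sequence converges pointwise; since bounds survive
  pointwise limits, the convergence is also in norm.\<close>

lemma rk_module_complete:
  assumes s: "\<And>n. s n \<in> rk_module"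
    and cauchy: "\<forall>\<epsilon>>0. \<exists>N. \<forall>m\<ge>N. \<forall>n\<ge>N. hm_norm rk_ip (\<lambda>z x. s m z x - s n z x) < \<epsilon>"
  shows "\<exists>F\<in>rk_module. (\<lambda>n. hm_norm rk_ip (\<lambda>z x. s n z x - F z x)) \<longlonglongrightarrow> 0"
proof -
  have bound: "\<exists>N. \<forall>m\<ge>N. \<forall>n\<ge>N. module_bound (\<lambda>z x. s m z x - s n z x) \<epsilon>" if \<epsilon>: "0 < \<epsilon>" for \<epsilon>
  proof -
    obtain N where N: "\<And>m n. N \<le> m \<Longrightarrow> N \<le> n \<Longrightarrow> hm_norm rk_ip (\<lambda>z x. s m z x - s n z x) < \<epsilon>"
      using cauchy \<epsilon> by blast
    have "module_bound (\<lambda>z x. s m z x - s n z x) \<epsilon>" if "N \<le> m" "N \<le> n" for m n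
      using module_bound_mono[OF module_bound_hm_norm[OF rk_module_diff[OF s s]] less_imp_le[OF N[OF that]]] .
    then show ?thesis by blast
  qed
  define \<kappa> where "\<kappa> z = sqrt (onorm (K z z))" for z
  have \<kappa>: "0 \<le> \<kappa> z" for z
    by (simp add: \<kappa>_def onorm_pos_le[OF bop_bounded_linear[OF K_in_bop]])
  have eval: "norm (F z x) \<le> C * norm x * \<kappa> z" if "module_bound F C" for F C z x
    using norm_eval_le[OF module_boundD[OF that, of x], of z] by (simp add: \<kappa>_def)
  have "convergent (\<lambda>n. s n z x)" for z x
  proof (rule Cauchy_convergent, rule metric_CauchyI)
    fix e :: real assume e: "0 < e"
    have pos: "0 < norm x * \<kappa> z + 1"
      using \<kappa>[of z] by (simp add: add_nonneg_pos)
    then have "0 < e / (norm x * \<kappa> z + 1)"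
      using e by simp
    then obtain N where N: "\<And>m n. N \<le> m \<Longrightarrow> N \<le> n \<Longrightarrow>
        module_bound (\<lambda>z x. s m z x - s n z x) (e / (norm x * \<kappa> z + 1))"
      using bound by blast
    have "dist (s m z x) (s n z x) < e" if "N \<le> m" "N \<le> n" for m n
    proof -
      have "norm (s m z x - s n z x) \<le> e / (norm x * \<kappa> z + 1) * norm x * \<kappa> z"
        by (rule eval[OF N[OF that]])
      also have "\<dots> < e"
        using e pos by (simp add: pos_divide_less_eq mult.assoc)
      finally show ?thesis by (simp add: dist_norm)
    qed
    then show "\<exists>N. \<forall>m\<ge>N. \<forall>n\<ge>N. dist (s m z x) (s n z x) < e" by blast
  qed
  then obtain F where lim: "\<And>z x. (\<lambda>n. s n z x) \<longlonglongrightarrow> F z x"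
    unfolding convergent_def by metis
  \<comment> \<open>In the Cauchy estimate \<open>n\<close> stays fixed and \<open>m\<close> tends
    to infinity.\<close>
  have F_bound: "\<exists>N. \<forall>n\<ge>N. module_bound (\<lambda>z x. s n z x - F z x) \<epsilon>" if \<epsilon>: "0 < \<epsilon>" for \<epsilon>
  proof -
    obtain N where N: "\<And>m n. N \<le> m \<Longrightarrow> N \<le> n \<Longrightarrow> module_bound (\<lambda>z x. s m z x - s n z x) \<epsilon>"
      using bound[OF \<epsilon>] by blast
    have "norm_bound (\<lambda>z. s n z x - F z x) (\<epsilon> * norm x)" if "N \<le> n" for n x
    proof (rule norm_bound_limit)
      show "(\<lambda>m. s n z x - s m z x) \<longlonglongrightarrow> s n z x - F z x" for z
        by (intro tendsto_intros lim)
      show "norm_bound (\<lambda>z. s n z x - s m z x) (\<epsilon> * norm x)" if "N \<le> m" for m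
        by (rule module_boundD[OF N[OF \<open>N \<le> n\<close> that]])
    qed
    then show ?thesis
      using \<epsilon> by (auto simp: module_bound_def)
  qed
  have F: "F \<in> rk_module"
  proof (rule rk_moduleI)
    fix z
    have cscale: "F z (cscale J c x) = cscale J c (F z x)" for c x
    proof (rule LIMSEQ_unique[OF lim])
      show "(\<lambda>n. s n z (cscale J c x)) \<longlonglongrightarrow> cscale J c (F z x)"
        unfolding bop_cscale_apply[OF rk_module_bop[OF s]]
        by (rule bounded_linear.tendsto[OF bounded_linear_cscale lim])
    qed
    \<comment> \<open>One member at distance at most 1 suffices for boundedness of
      \<open>F z\<close>: it contributes \<open>onorm (s N z)\<close>, and the difference
      contributes \<kappa> \<open>z\<close>.\<close>
    obtain N where N: "module_bound (\<lambda>z x. s N z x - F z x) 1"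
      using F_bound[OF zero_less_one] by blast
    have "bounded_linear (F z)"
    proof (rule bounded_linear_intro)
      show "F z (x + y) = F z x + F z y" for x y
      proof (rule LIMSEQ_unique[OF lim])
        show "(\<lambda>n. s n z (x + y)) \<longlonglongrightarrow> F z x + F z y"
          unfolding bop_add[OF rk_module_bop[OF s]] by (intro tendsto_add lim)
      qed
      show "F z (r *\<^sub>R x) = r *\<^sub>R F z x" for r x
        using cscale[of "complex_of_real r" x] by (simp only: cscale_of_real)
      show "norm (F z x) \<le> norm x * (onorm (s N z) + \<kappa> z)" for x
      proof -
        have "norm (F z x) \<le> norm (s N z x) + norm (s N z x - F z x)"
          using norm_triangle_sub[of "F z x" "s N z x"] by (simp add: norm_minus_commute)
        also have "\<dots> \<le> onorm (s N z) * norm x + norm x * \<kappa> z"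
          using eval[OF N, of z x] by (intro add_mono onorm bop_bounded_linear rk_module_bop s) simp
        finally show ?thesis
          by (simp add: algebra_simps)
      qed
    qed
    then show "F z \<in> bop J"
      using cscale[of \<i>] by (simp add: bop_def cscale_ii)
  next
    fix \<epsilon> :: real assume "0 < \<epsilon>"
    then have \<epsilon>2: "0 < \<epsilon> / 2" by simp
    obtain N where N: "module_bound (\<lambda>z x. s N z x - F z x) (\<epsilon> / 2)"
      using F_bound[OF \<epsilon>2] by blast
    \<comment> \<open>A sum that approximates \<open>s N\<close> within half the tolerance also
      approximates \<open>F\<close>.\<close>
    obtain ms where ms: "snd ` set ms \<subseteq> bop J"
      "module_bound (\<lambda>z x. s N z x - kfun (eval_list ms x) z) (\<epsilon> / 2)"
      by (rule rk_module_approx[OF s \<epsilon>2])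
    have "module_bound (\<lambda>z x. F z x - kfun (eval_list ms x) z) \<epsilon>"
      using module_bound_add[OF ms(2) module_bound_cscale[OF N, of "- 1"]]
      by (simp add: cscale_minus_one)
    with ms(1) show "\<exists>ms. snd ` set ms \<subseteq> bop J \<and>
        module_bound (\<lambda>z x. F z x - kfun (eval_list ms x) z) \<epsilon>" by blast
  qed
  have "(\<lambda>n. hm_norm rk_ip (\<lambda>z x. s n z x - F z x)) \<longlonglongrightarrow> 0"
  proof (rule LIMSEQ_I)
    fix \<epsilon> :: real assume \<epsilon>: "0 < \<epsilon>"
    then obtain N where N: "\<And>n. N \<le> n \<Longrightarrow> module_bound (\<lambda>z x. s n z x - F z x) (\<epsilon> / 2)"
      using F_bound[of "\<epsilon> / 2"] by auto
    have "norm (hm_norm rk_ip (\<lambda>z x. s n z x - F z x) - 0) < \<epsilon>" if "N \<le> n" for n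
      using hm_norm_le[OF rk_module_diff[OF s F] N[OF that]] \<epsilon>
        module_bound_nonneg[OF module_bound_hm_norm[OF rk_module_diff[OF s F]], of n]
      by simp
    then show "\<exists>N. \<forall>n\<ge>N. norm (hm_norm rk_ip (\<lambda>z x. s n z x - F z x) - 0) < \<epsilon>" by blast
  qed
  with F show ?thesis by blast
qed

section \<open>Verification of the module axioms and the reproducing property\<close>

lemma rk_ip_add_left:
  assumes F: "F \<in> rk_module" and G: "G \<in> rk_module" and L: "L \<in> rk_module"
  shows "rk_ip (\<lambda>z x. F z x + G z x) L = (\<lambda>x. rk_ip F L x + rk_ip G L x)"
proof (rule ext, rule ip_eqI)
  fix x y
  obtain C D where "norm_bound (\<lambda>z. F z x) C" "norm_bound (\<lambda>z. G z x) D"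
    using norm_bound_rk_module F G by blast
  from form_add_left[OF this approx_rk_module[OF L]]
  show "ip (rk_ip (\<lambda>z x. F z x + G z x) L x) y = ip (rk_ip F L x + rk_ip G L x) y"
    by (simp add: ip_add_left ip_rk_ip rk_module_add F G L)
qed

lemma rk_ip_cscale_left:
  assumes F: "F \<in> rk_module" and G: "G \<in> rk_module"
  shows "rk_ip (\<lambda>z x. cscale J c (F z x)) G = (\<lambda>x. cscale J c (rk_ip F G x))"
proof (rule ext, rule ip_eqI)
  fix x y
  obtain C where "norm_bound (\<lambda>z. F z x) C"
    using norm_bound_rk_module F by blast
  from form_cscale_left[OF this approx_rk_module[OF G]]
  show "ip (rk_ip (\<lambda>z x. cscale J c (F z x)) G x) y = ip (cscale J c (rk_ip F G x)) y"
    by (simp add: ip_cscale_left ip_rk_ip rk_module_cscale F G)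
qed

lemma rk_ip_comp_left:
  assumes F: "F \<in> rk_module" and G: "G \<in> rk_module" and b: "b \<in> bop J"
  shows "rk_ip (\<lambda>z. F z \<circ> b) G = rk_ip F G \<circ> b"
  by (rule ext, rule ip_eqI) (simp add: ip_rk_ip rk_module_comp[OF F b] F G comp_def)

lemma rk_ip_adjoint:
  assumes F: "F \<in> rk_module" and G: "G \<in> rk_module"
  shows "ip (rk_ip F G x) y = ip x (rk_ip G F y)"
proof -
  have "ip x (rk_ip G F y) = cnj (form (\<lambda>z. G z y) (\<lambda>z. F z x))"
    using ip_hermitian[of x "rk_ip G F y"] by (simp only: ip_rk_ip[OF G F])
  then show ?thesis
    using form_hermitian[OF approx_rk_module[OF F] approx_rk_module[OF G]]
    by (simp only: ip_rk_ip[OF F G])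
qed

lemma rk_ip_definite:
  assumes F: "F \<in> rk_module" and 0: "rk_ip F F = (\<lambda>x. 0)"
  shows "F = (\<lambda>z x. 0)"
proof (intro ext)
  fix z x
  have "hm_norm rk_ip F = 0"
    by (simp add: hm_norm_def 0 onorm_zero)
  then show "F z x = 0"
    using norm_eval_le[OF module_boundD[OF module_bound_hm_norm[OF F], of x], of z] by simp
qed

text \<open>For each \<open>y\<close> the function \<open>K(\<cdot>, w)y\<close> is the kernel sum
  of a one-element list, where \<open>form\<close> reduces to a pairing, that is, to
  \<open>ip (F w x) y\<close>.\<close>

lemma rk_ip_K:
  assumes F: "F \<in> rk_module"
  shows "rk_ip F (\<lambda>z. K z w) = F w"
proof (rule ext, rule ip_eqI)
  fix x y
  obtain C where C: "norm_bound (\<lambda>z. F z x) C"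
    using norm_bound_rk_module F by blast
  have "kfun [(w, y)] = (\<lambda>z. K z w y)"
    by (rule ext) simp
  then show "ip (rk_ip F (\<lambda>z. K z w) x) y = ip (F w x) y"
    using form_kfun[OF C, of "[(w, y)]"] by (simp add: ip_rk_ip F rk_module_K)
qed

lemma hilbert_fun_module_rk_module: "hilbert_fun_module J ip rk_module rk_ip"
  unfolding hilbert_fun_module_def
proof (intro conjI ballI allI impI)
  show "(\<lambda>z. F z \<circ> b) \<in> rk_module" if "F \<in> rk_module" "b \<in> bop J" for F b
    using rk_module_comp[OF that] by (simp add: comp_def)
  show "cnonneg (ip (rk_ip F F x) x)" if "F \<in> rk_module" for F x
    using cnonneg_form[OF approx_rk_module[OF that]] by (simp add: ip_rk_ip that)
  show "\<exists>F\<in>rk_module. (\<lambda>n. hm_norm rk_ip (\<lambda>z x. s n z x - F z x)) \<longlonglongrightarrow> 0"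
    if "\<forall>n. s n \<in> rk_module"
      "\<forall>\<epsilon>>0. \<exists>N. \<forall>m\<ge>N. \<forall>n\<ge>N. hm_norm rk_ip (\<lambda>z x. s m z x - s n z x) < \<epsilon>" for s
    using rk_module_complete that by blast
qed (simp_all add: rk_module_bop rk_module_zero rk_module_add rk_module_cscale rk_ip_in_bop
    rk_ip_add_left rk_ip_cscale_left rk_ip_comp_left rk_ip_adjoint rk_ip_definite)

lemma rk_properties_rk_module: "rk_properties J ip K rk_module rk_ip"
  unfolding rk_properties_def
proof (intro conjI ballI allI impI)
  fix F and \<epsilon> :: real
  assume F: "F \<in> rk_module" and \<epsilon>: "0 < \<epsilon>"
  \<comment> \<open>Halving turns the non-strict bound from \<open>hm_norm_le\<close> into the
    strict one required.\<close>
  then have "0 < \<epsilon> / 2" by simp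
  then obtain ms where ms: "snd ` set ms \<subseteq> bop J"
    and *: "module_bound (\<lambda>z x. F z x - kfun (eval_list ms x) z) (\<epsilon> / 2)"
    by (rule rk_module_approx[OF F])
  let ?n = "length ms" and ?ws = "\<lambda>i. fst (ms ! i)" and ?bs = "\<lambda>i. snd (ms ! i)"
  have bs: "\<forall>i<?n. ?bs i \<in> bop J"
    using ms by (auto simp: image_subset_iff)
  have eq: "kfun (eval_list ms x) z = (\<Sum>i<?n. K z (?ws i) (?bs i x))" for x z
    by (simp add: kfun_def eval_list_def sum_list_sum_nth atLeast0LessThan case_prod_beta)
  have "(\<lambda>z x. kfun (eval_list ms x) z) \<in> rk_module"
  proof (rule rk_moduleI)
    show "(\<lambda>x. kfun (eval_list ms x) z) \<in> bop J" for z
      using ms by (induction ms) (auto intro!: zero_in_bop add_in_bop comp_in_bop[OF K_in_bop])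
  qed (use ms in \<open>auto intro!: exI[of _ ms] simp: module_bound_zero\<close>)
  from hm_norm_le[OF rk_module_diff[OF F this] *] \<epsilon>
  have "hm_norm rk_ip (\<lambda>z x. F z x - (\<Sum>i<?n. K z (?ws i) (?bs i x))) < \<epsilon>"
    by (simp add: eq)
  then show "\<exists>n (ws :: nat \<Rightarrow> 'w) bs. (\<forall>i<n. bs i \<in> bop J) \<and>
      hm_norm rk_ip (\<lambda>z x. F z x - (\<Sum>i<n. K z (ws i) (bs i x))) < \<epsilon>"
    by (intro exI[of _ ?n] exI[of _ ?ws] exI[of _ ?bs] conjI bs)
qed (simp_all add: rk_module_K rk_ip_K)

end


section \<open>Uniqueness\<close>

locale fun_module = chilbert J ip
  for J :: "'e::{real_normed_vector,complete_space} \<Rightarrow> 'e" and ip +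
  fixes H :: "('w \<Rightarrow> 'e \<Rightarrow> 'e) set" and ipH
  assumes hilbert_fun_module: "hilbert_fun_module J ip H ipH"
begin

lemmas module_axioms = hilbert_fun_module[unfolded hilbert_fun_module_def]

lemma H_zero: "(\<lambda>z x. 0) \<in> H"
  by (rule module_axioms[THEN conjunct2, THEN conjunct1, rule_format])

lemma H_add: "F \<in> H \<Longrightarrow> G \<in> H \<Longrightarrow> (\<lambda>z x. F z x + G z x) \<in> H"
  by (rule module_axioms[THEN conjunct2, THEN conjunct2, THEN conjunct1, rule_format])

lemma H_cscale: "F \<in> H \<Longrightarrow> (\<lambda>z x. cscale J c (F z x)) \<in> H"
  by (rule module_axioms[THEN conjunct2, THEN conjunct2, THEN conjunct2, THEN conjunct1,
      rule_format])

lemma H_comp: "F \<in> H \<Longrightarrow> b \<in> bop J \<Longrightarrow> (\<lambda>z. F z \<circ> b) \<in> H"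
  by (rule module_axioms[THEN conjunct2, THEN conjunct2, THEN conjunct2, THEN conjunct2,
      THEN conjunct1, rule_format])

lemma ipH_bop: "F \<in> H \<Longrightarrow> G \<in> H \<Longrightarrow> ipH F G \<in> bop J"
  by (rule module_axioms[THEN conjunct2, THEN conjunct2, THEN conjunct2, THEN conjunct2,
      THEN conjunct2, THEN conjunct1, rule_format])

lemma ipH_add_left:
  "F \<in> H \<Longrightarrow> G \<in> H \<Longrightarrow> L \<in> H \<Longrightarrow> ipH (\<lambda>z x. F z x + G z x) L = (\<lambda>x. ipH F L x + ipH G L x)"
  by (rule module_axioms[THEN conjunct2, THEN conjunct2, THEN conjunct2, THEN conjunct2,
      THEN conjunct2, THEN conjunct2, THEN conjunct1, rule_format])

lemma ipH_cscale_left: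
  "F \<in> H \<Longrightarrow> G \<in> H \<Longrightarrow> ipH (\<lambda>z x. cscale J c (F z x)) G = (\<lambda>x. cscale J c (ipH F G x))"
  by (rule module_axioms[THEN conjunct2, THEN conjunct2, THEN conjunct2, THEN conjunct2,
      THEN conjunct2, THEN conjunct2, THEN conjunct2, THEN conjunct1, rule_format])

lemma ipH_comp_left: "F \<in> H \<Longrightarrow> G \<in> H \<Longrightarrow> b \<in> bop J \<Longrightarrow> ipH (\<lambda>z. F z \<circ> b) G = ipH F G \<circ> b"
  by (rule module_axioms[THEN conjunct2, THEN conjunct2, THEN conjunct2, THEN conjunct2,
      THEN conjunct2, THEN conjunct2, THEN conjunct2, THEN conjunct2, THEN conjunct1, rule_format])

lemma ipH_adjoint: "F \<in> H \<Longrightarrow> G \<in> H \<Longrightarrow> ip (ipH F G x) y = ip x (ipH G F y)"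
  by (rule module_axioms[THEN conjunct2, THEN conjunct2, THEN conjunct2, THEN conjunct2,
      THEN conjunct2, THEN conjunct2, THEN conjunct2, THEN conjunct2, THEN conjunct2,
      THEN conjunct1, rule_format])

lemma ipH_positive: "F \<in> H \<Longrightarrow> cnonneg (ip (ipH F F x) x)"
  by (rule module_axioms[THEN conjunct2, THEN conjunct2, THEN conjunct2, THEN conjunct2,
      THEN conjunct2, THEN conjunct2, THEN conjunct2, THEN conjunct2, THEN conjunct2,
      THEN conjunct2, THEN conjunct1, rule_format])

lemma H_complete:
  fixes s :: "nat \<Rightarrow> 'w \<Rightarrow> 'e \<Rightarrow> 'e"
  assumes "\<And>n. s n \<in> H"
    and "\<forall>\<epsilon>>0. \<exists>N. \<forall>m\<ge>N. \<forall>n\<ge>N. hm_norm ipH (\<lambda>z x. s m z x - s n z x) < \<epsilon>"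
  shows "\<exists>F\<in>H. (\<lambda>n. hm_norm ipH (\<lambda>z x. s n z x - F z x)) \<longlonglongrightarrow> 0"
  using module_axioms[THEN conjunct2, THEN conjunct2, THEN conjunct2, THEN conjunct2,
      THEN conjunct2, THEN conjunct2, THEN conjunct2, THEN conjunct2, THEN conjunct2,
      THEN conjunct2, THEN conjunct2, THEN conjunct2] assms by blast

lemma H_diff:
  assumes "F \<in> H" "G \<in> H"
  shows "(\<lambda>z x. F z x - G z x) \<in> H"
  using H_add[OF assms(1) H_cscale[OF assms(2), of "- 1"]] by (simp add: cscale_minus_one)

lemma ip_ipH_hermitian:
  assumes "F \<in> H" "G \<in> H"
  shows "ip (ipH F G x) y = cnj (ip (ipH G F y) x)"
  using ipH_adjoint[OF assms, of x y] ip_hermitian[of x "ipH G F y"] by (simp only:)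

lemma ipH_diff_left:
  assumes "F \<in> H" "G \<in> H" "L \<in> H"
  shows "ipH (\<lambda>z x. F z x - G z x) L = (\<lambda>x. ipH F L x - ipH G L x)"
  using ipH_add_left[OF assms(1) H_cscale[OF assms(2), of "- 1"] assms(3)]
    ipH_cscale_left[OF assms(2,3), of "- 1"]
  by (simp add: cscale_minus_one)

text \<open>The axioms give linearity in the first slot only. The second slot is reached through the
  adjoint relation, hence the formulation inside \<open>ip\<close>.\<close>

lemma ip_ipH_add_right:
  assumes "F \<in> H" "G \<in> H" "L \<in> H"
  shows "ip (ipH L (\<lambda>z x. F z x + G z x) x) y = ip (ipH L F x) y + ip (ipH L G x) y"
  using assms by (simp add: ipH_adjoint H_add ipH_add_left ip_add_right)

lemma ip_ipH_diff_right:
  assumes "F \<in> H" "G \<in> H" "L \<in> H"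
  shows "ip (ipH L (\<lambda>z x. F z x - G z x) x) y = ip (ipH L F x) y - ip (ipH L G x) y"
  using assms by (simp add: ipH_adjoint H_diff ipH_diff_left ip_diff_right)

lemma ip_ipH_comp_right:
  assumes F: "F \<in> H" and L: "L \<in> H" and b: "b \<in> bop J"
  shows "ip (ipH L (\<lambda>z. F z \<circ> b) x) y = ip (ipH L F x) (b y)"
  using assms by (simp add: ipH_adjoint[OF L] H_comp ipH_comp_left)

text \<open>For fixed \<open>x\<close>, the map sending \<open>F\<close> and \<open>G\<close> to
  \<open>ip (ipH F G x) x\<close> is a positive semidefinite form, so ordinary Cauchy-Schwarz
  applies. The same \<open>x\<close> stands in both places because positivity is an axiom about
  diagonal values.\<close>

lemma cmod_ip_ipH_self_le:
  assumes F: "F \<in> H" and G: "G \<in> H"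
  shows "cmod (ip (ipH F G x) x) \<le> sqrt (Re (ip (ipH F F x) x)) * sqrt (Re (ip (ipH G G x) x))"
proof -
  let ?a = "ip (ipH G G x) x" and ?b = "ip (ipH F G x) x" and ?c = "ip (ipH F F x) x"
  have real: "?a = complex_of_real (Re ?a)" "?c = complex_of_real (Re ?c)"
    using ipH_positive F G by (simp_all add: cnonneg_def complex_eq_iff)
  have "0 \<le> Re ?a + 2 * Re (t * ?b) + (cmod t)\<^sup>2 * Re ?c" for t
  proof -
    let ?F = "\<lambda>z x. cscale J t (F z x)"
    let ?L = "\<lambda>z x. G z x + ?F z x"
    have tF: "?F \<in> H" and L: "?L \<in> H"
      using F G by (simp_all add: H_add H_cscale)
    have 1: "ip (ipH ?F G x) x = t * ?b"
      using F G by (simp add: ipH_cscale_left ip_cscale_left)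
    have 2: "ip (ipH G ?F x) x = cnj (t * ?b)"
      using ip_ipH_hermitian[OF G tF] 1 by (simp only:)
    have "ip (ipH F ?F x) x = cnj (t * ?c)"
      using ip_ipH_hermitian[OF F tF] F by (simp add: ipH_cscale_left ip_cscale_left)
    then have 3: "ip (ipH ?F ?F x) x = (t * cnj t) * ?c"
      using F tF real(2) by (simp add: ipH_cscale_left ip_cscale_left) (metis complex_cnj_complex_of_real)
    have "ip (ipH ?L ?L x) x = ?a + (t * ?b + cnj (t * ?b)) + (t * cnj t) * ?c"
      by (simp only: ipH_add_left[OF G tF L] ip_add_left ip_ipH_add_right[OF G tF G]
          ip_ipH_add_right[OF G tF tF] 1 2 3) (simp only: add_ac)
    also have "\<dots> = complex_of_real (Re ?a + 2 * Re (t * ?b) + (cmod t)\<^sup>2 * Re ?c)"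
      by (subst real(1), subst real(2), simp only: complex_add_cnj complex_norm_square[symmetric]) simp
    finally show ?thesis
      using ipH_positive[OF L, of x] by (simp only: cnonneg_def Re_complex_of_real)
  qed
  then have "cmod ?b \<le> sqrt (Re ?a) * sqrt (Re ?c)"
    by (rule norm_le_sqrt_mult_if_quadratic_nonneg) (use ipH_positive[OF F] in \<open>simp add: cnonneg_def\<close>)
  then show ?thesis by (simp only: mult.commute)
qed

lemma hm_norm_nonneg: "F \<in> H \<Longrightarrow> 0 \<le> hm_norm ipH F"
  by (simp add: hm_norm_def onorm_pos_le bop_bounded_linear ipH_bop)

lemma sqrt_ip_ipH_le:
  assumes F: "F \<in> H"
  shows "sqrt (Re (ip (ipH F F x) x)) \<le> hm_norm ipH F * norm x"
proof -
  have "Re (ip (ipH F F x) x) \<le> norm (ipH F F x) * norm x"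
    using cmod_ip_le complex_Re_le_cmod order_trans by blast
  also have "\<dots> \<le> onorm (ipH F F) * norm x * norm x"
    by (intro mult_right_mono onorm bop_bounded_linear ipH_bop F) simp
  finally have "sqrt (Re (ip (ipH F F x) x)) \<le> sqrt (onorm (ipH F F) * (norm x)\<^sup>2)"
    by (intro real_sqrt_le_mono) (simp add: power2_eq_square mult.assoc)
  then show ?thesis
    by (simp add: hm_norm_def real_sqrt_mult)
qed

text \<open>The case \<open>x \<noteq> y\<close> reduces to \<open>x = y\<close>: write \<open>x = b y\<close> with \<open>b\<close> of rank one and absorb \<open>b\<close> into \<open>F\<close>.\<close>

lemma cmod_ip_ipH_le:
  assumes F: "F \<in> H" and G: "G \<in> H"
  shows "cmod (ip (ipH F G x) y) \<le> hm_norm ipH F * hm_norm ipH G * norm x * norm y"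
proof (cases "y = 0")
  case False
  then obtain b where b: "b \<in> bop J" and x: "b y = x"
    using ex_bop_map by blast
  let ?F = "\<lambda>z. F z \<circ> b"
  have F': "?F \<in> H" by (rule H_comp[OF F b])
  have "ip (ipH F G x) y = ip (ipH ?F G y) y"
    by (simp add: ipH_comp_left F G b x)
  moreover have "ip (ipH ?F ?F y) y = ip (ipH F F x) x"
    by (simp add: ipH_comp_left F F' b x ip_ipH_comp_right)
  ultimately have "cmod (ip (ipH F G x) y) \<le> sqrt (Re (ip (ipH F F x) x)) * sqrt (Re (ip (ipH G G y) y))"
    using cmod_ip_ipH_self_le[OF F' G, of y] by (simp only:)
  also have "\<dots> \<le> (hm_norm ipH F * norm x) * (hm_norm ipH G * norm y)"
    by (intro mult_mono sqrt_ip_ipH_le F G mult_nonneg_nonneg hm_norm_nonneg)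
      (use ipH_positive[OF G] in \<open>simp_all add: cnonneg_def\<close>)
  finally show ?thesis
    by (simp only: mult_ac)
qed simp

lemma norm_ipH_le:
  assumes F: "F \<in> H" and G: "G \<in> H"
  shows "norm (ipH F G x) \<le> hm_norm ipH F * hm_norm ipH G * norm x"
  by (rule norm_le_if_ip_le) (simp_all add: cmod_ip_ipH_le F G hm_norm_nonneg)

text \<open>Expand the inner square of the difference into four terms and bound each by
  Cauchy-Schwarz; the bounds add up to the square of the sum of the two norms.\<close>

lemma hm_norm_diff_le:
  assumes F: "F \<in> H" and G: "G \<in> H"
  shows "hm_norm ipH (\<lambda>z x. F z x - G z x) \<le> hm_norm ipH F + hm_norm ipH G"
proof -
  let ?L = "\<lambda>z x. F z x - G z x" and ?a = "hm_norm ipH F" and ?b = "hm_norm ipH G"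
  have a: "0 \<le> ?a" and b: "0 \<le> ?b"
    by (rule hm_norm_nonneg, fact)+
  have L: "?L \<in> H" by (rule H_diff[OF F G])
  have "cmod (ip (ipH ?L ?L x) y) \<le> (?a + ?b)\<^sup>2 * norm x * norm y" for x y
  proof -
    have "cmod (ip (ipH ?L ?L x) y) = cmod ((ip (ipH F F x) y - ip (ipH F G x) y)
        - (ip (ipH G F x) y - ip (ipH G G x) y))"
      by (simp only: ipH_diff_left[OF F G L] ip_diff_left ip_ipH_diff_right[OF F G F] ip_ipH_diff_right[OF F G G])
    also have "\<dots> \<le> (cmod (ip (ipH F F x) y) + cmod (ip (ipH F G x) y))
        + (cmod (ip (ipH G F x) y) + cmod (ip (ipH G G x) y))"
      by (intro order_trans[OF norm_triangle_ineq4] add_mono norm_triangle_ineq4)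
    also have "\<dots> \<le> (?a * ?a * norm x * norm y + ?a * ?b * norm x * norm y)
        + (?b * ?a * norm x * norm y + ?b * ?b * norm x * norm y)"
      by (intro add_mono cmod_ip_ipH_le F G)
    also have "\<dots> = (?a + ?b)\<^sup>2 * norm x * norm y"
      by (simp add: power2_eq_square algebra_simps)
    finally show ?thesis .
  qed
  then have "norm (ipH ?L ?L x) \<le> (?a + ?b)\<^sup>2 * norm x" for x
    by (intro norm_le_if_ip_le) simp_all
  then have "onorm (ipH ?L ?L) \<le> (?a + ?b)\<^sup>2"
    by (intro onorm_bound) simp_all
  then have "sqrt (onorm (ipH ?L ?L)) \<le> sqrt ((?a + ?b)\<^sup>2)"
    by (rule real_sqrt_le_mono)
  then show ?thesis
    using a b by (simp add: hm_norm_def[of ipH ?L])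
qed

lemma ipH_diff_diff:
  assumes F: "F \<in> H" and G: "G \<in> H"
  shows "ip (ipH (\<lambda>z x. F z x - G z x) (\<lambda>z x. F z x - G z x) x) y
    = ip (ipH F F x) y - ip (ipH F G x) y - ip (ipH G F x) y + ip (ipH G G x) y"
  using ipH_diff_left[OF F G H_diff[OF F G]] ip_ipH_diff_right[OF F G F] ip_ipH_diff_right[OF F G G]
  by (simp add: ip_diff_left)

lemma hm_norm_minus_commute:
  assumes F: "F \<in> H" and G: "G \<in> H"
  shows "hm_norm ipH (\<lambda>z x. F z x - G z x) = hm_norm ipH (\<lambda>z x. G z x - F z x)"
proof -
  have "ipH (\<lambda>z x. F z x - G z x) (\<lambda>z x. F z x - G z x) = ipH (\<lambda>z x. G z x - F z x) (\<lambda>z x. G z x - F z x)"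
    by (rule ext, rule ip_eqI) (simp add: ipH_diff_diff F G)
  then show ?thesis by (simp add: hm_norm_def)
qed

end

section \<open>Modules with the reproducing property\<close>

definition kernel_sum ::
  "('w \<Rightarrow> 'w \<Rightarrow> 'e \<Rightarrow> 'e) \<Rightarrow> nat \<Rightarrow> (nat \<Rightarrow> 'w) \<Rightarrow> (nat \<Rightarrow> 'e \<Rightarrow> 'e::real_normed_vector) \<Rightarrow> 'w \<Rightarrow> 'e \<Rightarrow> 'e" where
  "kernel_sum K n ws bs = (\<lambda>z x. \<Sum>i<n. K z (ws i) (bs i x))"

locale rk_fun_module = fun_module J ip H ipH
  for J :: "'e::{real_normed_vector,complete_space} \<Rightarrow> 'e" and ip
    and H :: "('w \<Rightarrow> 'e \<Rightarrow> 'e) set" and ipH +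
  fixes K :: "'w \<Rightarrow> 'w \<Rightarrow> 'e \<Rightarrow> 'e"
  assumes rk_properties: "rk_properties J ip K H ipH"
begin

lemma K_in_H: "(\<lambda>z. K z w) \<in> H"
  using rk_properties unfolding rk_properties_def by blast

lemma reproducing: "F \<in> H \<Longrightarrow> ipH F (\<lambda>z. K z w) = F w"
  using rk_properties unfolding rk_properties_def by blast

lemma kernel_sum_dense:
  assumes "F \<in> H" "0 < \<epsilon>"
  shows "\<exists>n ws bs. (\<forall>i<n. bs i \<in> bop J) \<and> hm_norm ipH (\<lambda>z x. F z x - kernel_sum K n ws bs z x) < \<epsilon>"
  using rk_properties assms unfolding rk_properties_def kernel_sum_def by blast

lemma kernel_sum_Suc:
  "kernel_sum K (Suc n) ws bs = (\<lambda>z x. kernel_sum K n ws bs z x + (K z (ws n) \<circ> bs n) x)"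
  by (simp add: kernel_sum_def)

lemma kernel_sum_in_H: "\<forall>i<n. bs i \<in> bop J \<Longrightarrow> kernel_sum K n ws bs \<in> H"
proof (induction n)
  case 0
  then show ?case by (simp add: kernel_sum_def H_zero)
next
  case (Suc n)
  then show ?case
    unfolding kernel_sum_Suc by (intro H_add H_comp K_in_H) simp_all
qed

text \<open>The reproducing property evaluates each term. The right-hand side no longer mentions
  \<open>ipH\<close>, so every module with these properties gives the same values on kernel
  sums.\<close>

lemma ip_ipH_kernel_sum:
  assumes F: "F \<in> H"
  shows "\<forall>i<n. bs i \<in> bop J \<Longrightarrow>
    ip (ipH F (kernel_sum K n ws bs) x) y = (\<Sum>i<n. ip (F (ws i) x) (bs i y))"
proof (induction n)
  case 0
  have "ipH (\<lambda>z x. 0) F y = 0"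
    using ipH_diff_left[OF F F F] by simp
  then show ?case
    by (simp add: kernel_sum_def ipH_adjoint F H_zero)
next
  case (Suc n)
  then have S: "kernel_sum K n ws bs \<in> H" and b: "bs n \<in> bop J"
    by (simp_all add: kernel_sum_in_H)
  have "ip (ipH F (\<lambda>z. K z (ws n) \<circ> bs n) x) y = ip (F (ws n) x) (bs n y)"
    by (simp add: ip_ipH_comp_right[OF K_in_H F b] reproducing[OF F])
  then show ?case
    unfolding kernel_sum_Suc
    using Suc.IH Suc.prems ip_ipH_add_right[OF S H_comp[OF K_in_H b] F]
    by simp
qed

text \<open>\<open>F w\<close> is itself the inner product of \<open>F\<close> with
  \<open>K(\<cdot>, w)\<close>, so Cauchy-Schwarz bounds evaluation. Norm limits are therefore
  pointwise limits, which lets limits taken in different modules be compared.\<close>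

lemma norm_apply_le:
  assumes "F \<in> H"
  shows "norm (F w x) \<le> hm_norm ipH F * hm_norm ipH (\<lambda>z. K z w) * norm x"
  using norm_ipH_le[OF assms K_in_H] by (simp add: reproducing assms)

lemma tendsto_apply:
  assumes s: "\<And>n. s n \<in> H" and F: "F \<in> H"
    and lim: "(\<lambda>n. hm_norm ipH (\<lambda>z x. s n z x - F z x)) \<longlonglongrightarrow> 0"
  shows "(\<lambda>n. s n w x) \<longlonglongrightarrow> F w x"
proof (rule LIM_zero_cancel, rule Lim_null_comparison[OF always_eventually[OF allI]])
  show "norm (s n w x - F w x) \<le> hm_norm ipH (\<lambda>z x. s n z x - F z x) * (hm_norm ipH (\<lambda>z. K z w) * norm x)" for n
    using norm_apply_le[OF H_diff[OF s F]] by (simp only: mult.assoc)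
  show "(\<lambda>n. hm_norm ipH (\<lambda>z x. s n z x - F z x) * (hm_norm ipH (\<lambda>z. K z w) * norm x)) \<longlonglongrightarrow> 0"
    by (rule tendsto_mult_left_zero[OF lim])
qed

lemma tendsto_ip_ipH:
  assumes s: "\<And>n. s n \<in> H" and F: "F \<in> H" and G: "G \<in> H"
    and lim: "(\<lambda>n. hm_norm ipH (\<lambda>z x. s n z x - G z x)) \<longlonglongrightarrow> 0"
  shows "(\<lambda>n. ip (ipH F (s n) x) y) \<longlonglongrightarrow> ip (ipH F G x) y"
proof (rule LIM_zero_cancel, rule Lim_null_comparison[OF always_eventually[OF allI]])
  show "norm (ip (ipH F (s n) x) y - ip (ipH F G x) y)
      \<le> hm_norm ipH (\<lambda>z x. s n z x - G z x) * (hm_norm ipH F * norm x * norm y)" for n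
    using cmod_ip_ipH_le[OF F H_diff[OF s G]] ip_ipH_diff_right[OF s G F]
    by (simp only: mult_ac)
  show "(\<lambda>n. hm_norm ipH (\<lambda>z x. s n z x - G z x) * (hm_norm ipH F * norm x * norm y)) \<longlonglongrightarrow> 0"
    by (rule tendsto_mult_left_zero[OF lim])
qed

end

section \<open>Comparison of two reproducing modules\<close>

text \<open>Kernel sums approximating a member of \<open>H1\<close> are Cauchy in \<open>H2\<close>
  as well, since the two norms agree on differences of such sums. The limit in \<open>H2\<close> is
  the same function because both limits are pointwise. Only one inclusion is proved; exchanging the
  modules gives the other.\<close>

lemma rk_fun_module_unique_aux:
  assumes "rk_fun_module J ip H1 ip1 K" and "rk_fun_module J ip H2 ip2 K"
  shows "H1 \<subseteq> H2" and "\<And>F G. F \<in> H1 \<Longrightarrow> G \<in> H1 \<Longrightarrow> ip2 F G = ip1 F G"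
proof -
  interpret M1: rk_fun_module J ip H1 ip1 K by (rule assms)
  interpret M2: rk_fun_module J ip H2 ip2 K by (rule assms)
  define P where "P = {kernel_sum K n ws bs | n ws bs. \<forall>i<n. bs i \<in> bop J}"
  have P1: "S \<in> H1" and P2: "S \<in> H2" if "S \<in> P" for S
    using that M1.kernel_sum_in_H M2.kernel_sum_in_H by (auto simp: P_def)
  have ip_eq: "ip (ip2 F S x) y = ip (ip1 F S x) y" if "F \<in> H1" "F \<in> H2" "S \<in> P" for F S x y
    using that by (auto simp: P_def M1.ip_ipH_kernel_sum M2.ip_ipH_kernel_sum)
  have norm_eq: "hm_norm ip2 (\<lambda>z x. S z x - T z x) = hm_norm ip1 (\<lambda>z x. S z x - T z x)"
    if S: "S \<in> P" and T: "T \<in> P" for S T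
  proof -
    have "ip2 (\<lambda>z x. S z x - T z x) (\<lambda>z x. S z x - T z x) = ip1 (\<lambda>z x. S z x - T z x) (\<lambda>z x. S z x - T z x)"
      by (rule ext, rule M1.ip_eqI)
        (simp add: M1.ipH_diff_diff M2.ipH_diff_diff P1 P2 ip_eq S T)
    then show ?thesis by (simp add: hm_norm_def)
  qed
  have main: "F \<in> H2 \<and> (\<exists>s. (\<forall>n. s n \<in> P) \<and>
      (\<lambda>n. hm_norm ip1 (\<lambda>z x. s n z x - F z x)) \<longlonglongrightarrow> 0 \<and>
      (\<lambda>n. hm_norm ip2 (\<lambda>z x. s n z x - F z x)) \<longlonglongrightarrow> 0)" if F: "F \<in> H1" for F
  proof -
    have "\<exists>S\<in>P. hm_norm ip1 (\<lambda>z x. F z x - S z x) < 1 / real (Suc n)" for n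
    proof -
      have "0 < 1 / real (Suc n)" by simp
      from M1.kernel_sum_dense[OF F this] obtain m ws bs where "\<forall>i<m. bs i \<in> bop J"
        and "hm_norm ip1 (\<lambda>z x. F z x - kernel_sum K m ws bs z x) < 1 / real (Suc n)"
        by blast
      moreover from this(1) have "kernel_sum K m ws bs \<in> P"
        unfolding P_def by blast
      ultimately show ?thesis by blast
    qed
    then obtain s where sP: "\<And>n. s n \<in> P"
      and s: "\<And>n. hm_norm ip1 (\<lambda>z x. F z x - s n z x) < 1 / real (Suc n)"
      by metis
    have s1: "s n \<in> H1" and s2: "s n \<in> H2" for n
      using P1 P2 sP by blast+
    have inv: "(\<lambda>n. 1 / real (Suc n)) \<longlonglongrightarrow> 0"
      by (rule LIMSEQ_Suc[OF lim_1_over_n])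
    have lim1: "(\<lambda>n. hm_norm ip1 (\<lambda>z x. s n z x - F z x)) \<longlonglongrightarrow> 0"
    proof (rule Lim_null_comparison[OF always_eventually[OF allI] inv])
      show "norm (hm_norm ip1 (\<lambda>z x. s n z x - F z x)) \<le> 1 / real (Suc n)" for n
        using s[of n] M1.hm_norm_nonneg[OF M1.H_diff[OF F s1], of n]
        unfolding M1.hm_norm_minus_commute[OF s1 F] by simp
    qed
    \<comment> \<open>The triangle inequality is applied in \<open>H1\<close>, where
      \<open>F\<close> is known to lie, and the left side is then moved to \<open>ip2\<close> by
      \<open>norm_eq\<close>.\<close>
    have cauchy: "hm_norm ip2 (\<lambda>z x. s m z x - s n z x)
        \<le> hm_norm ip1 (\<lambda>z x. F z x - s n z x) + hm_norm ip1 (\<lambda>z x. F z x - s m z x)" for m n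
      using M1.hm_norm_diff_le[OF M1.H_diff[OF F s1] M1.H_diff[OF F s1], of n m]
      by (simp add: norm_eq[OF sP sP])
    have "\<exists>N. \<forall>m\<ge>N. \<forall>n\<ge>N. hm_norm ip2 (\<lambda>z x. s m z x - s n z x) < \<epsilon>" if \<epsilon>: "0 < \<epsilon>" for \<epsilon>
    proof -
      have "\<forall>\<^sub>F n in sequentially. 1 / real (Suc n) < \<epsilon> / 2"
        by (rule order_tendstoD(2)[OF inv]) (use \<epsilon> in simp)
      then obtain N where N: "\<And>n. N \<le> n \<Longrightarrow> 1 / real (Suc n) < \<epsilon> / 2"
        by (auto simp: eventually_sequentially)
      have "hm_norm ip2 (\<lambda>z x. s m z x - s n z x) < \<epsilon>" if "N \<le> m" "N \<le> n" for m n
        using cauchy[of m n] s[of m] s[of n] N[OF that(1)] N[OF that(2)] by linarith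
      then show ?thesis by blast
    qed
    then have "\<forall>\<epsilon>>0. \<exists>N. \<forall>m\<ge>N. \<forall>n\<ge>N. hm_norm ip2 (\<lambda>z x. s m z x - s n z x) < \<epsilon>"
      by (intro allI impI)
    from M2.H_complete[OF s2 this] obtain F' where F': "F' \<in> H2"
      and lim2: "(\<lambda>n. hm_norm ip2 (\<lambda>z x. s n z x - F' z x)) \<longlonglongrightarrow> 0"
      by (elim bexE)
    have "F' = F"
      by (intro ext) (rule LIMSEQ_unique[OF M2.tendsto_apply[OF s2 F' lim2] M1.tendsto_apply[OF s1 F lim1]])
    with F' lim2 lim1 sP show ?thesis by blast
  qed
  then show sub: "H1 \<subseteq> H2" by blast
  \<comment> \<open>Both inner products are continuous in the second argument and agree there on
    kernel sums; one sequence converges to \<open>G\<close> in both norms.\<close>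
  show "ip2 F G = ip1 F G" if F: "F \<in> H1" and G: "G \<in> H1" for F G
  proof (rule ext, rule M1.ip_eqI)
    fix x y
    obtain s where sP: "\<And>n. s n \<in> P"
      and lim1: "(\<lambda>n. hm_norm ip1 (\<lambda>z x. s n z x - G z x)) \<longlonglongrightarrow> 0"
      and lim2: "(\<lambda>n. hm_norm ip2 (\<lambda>z x. s n z x - G z x)) \<longlonglongrightarrow> 0"
      using main[OF G] by blast
    have F2: "F \<in> H2" and G2: "G \<in> H2"
      using F G sub by blast+
    have "(\<lambda>n. ip (ip1 F (s n) x) y) \<longlonglongrightarrow> ip (ip1 F G x) y"
      by (rule M1.tendsto_ip_ipH[OF P1[OF sP] F G lim1])
    moreover have "(\<lambda>n. ip (ip1 F (s n) x) y) \<longlonglongrightarrow> ip (ip2 F G x) y"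
      using M2.tendsto_ip_ipH[OF P2[OF sP] F2 G2 lim2, of x y] by (simp only: ip_eq[OF F F2 sP])
    ultimately show "ip (ip2 F G x) y = ip (ip1 F G x) y"
      by (rule LIMSEQ_unique[rotated])
  qed
qed

lemma rk_fun_module_unique:
  assumes "rk_fun_module J ip H1 ip1 K" and "rk_fun_module J ip H2 ip2 K"
  shows "H2 = H1" and "\<And>F G. F \<in> H1 \<Longrightarrow> G \<in> H1 \<Longrightarrow> ip2 F G = ip1 F G"
  using rk_fun_module_unique_aux[OF assms] rk_fun_module_unique_aux(1)[OF assms(2,1)] by auto

text \<open>The inner products are compared on \<open>H\<close> only, because the module axioms
  leave a total function arbitrary outside it.\<close>

theorem theoremT:
  fixes J :: "'e::{real_normed_vector,complete_space} \<Rightarrow> 'e"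
    and ip :: "'e \<Rightarrow> 'e \<Rightarrow> complex"
    and K :: "'w \<Rightarrow> 'w \<Rightarrow> 'e \<Rightarrow> 'e"
  assumes "complex_hilbert J ip"
    and "positive_kernel J ip K"
  shows "\<exists>H ipH. hilbert_fun_module J ip H ipH \<and> rk_properties J ip K H ipH \<and>
           (\<forall>H' ipH'. hilbert_fun_module J ip H' ipH' \<and> rk_properties J ip K H' ipH' \<longrightarrow>
              H' = H \<and> (\<forall>F\<in>H. \<forall>G\<in>H. ipH' F G = ipH F G))"
proof -
  interpret kernel J ip K
    by unfold_locales (rule assms)+
  have rk: "rk_fun_module J ip H ipH K"
    if "hilbert_fun_module J ip H ipH" "rk_properties J ip K H ipH" for H ipH
    by unfold_locales (rule that)+
  note rk_fun_module_unique[OF rk[OF hilbert_fun_module_rk_module rk_properties_rk_module] rk]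
  then show ?thesis
    using hilbert_fun_module_rk_module rk_properties_rk_module
    by (intro exI[of _ rk_module] exI[of _ rk_ip]) blast
qed

end
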